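(* Let $F$ be a field. The mappings $X\mapsto A(X)$ and $A\mapsto\{A_M: M\in\mathrm{Max}(A)\}$ define a bijection (the two mappings being inverse to each other) between the nonempty quasicompact sets $X$ of rank one valuation rings in $\mathrm{Zar}(F)$ with $J(X)\neq 0$ and the one-dimensional Prüfer domains $A$ with nonzero Jacobson radical and quotient field $F$.
   Context: For a field $F$, $\mathrm{Zar}(F)$ denotes the set of valuation rings of $F$, i.e. the subrings $V$ of $F$ such that for all $0\neq t\in F$, $t\in V$ or $t^{-1}\in V$. The Zariski topology on $\mathrm{Zar}(F)$ has as a basis of open sets the sets $\{V\in\mathrm{Zar}(F): x_1,\ldots,x_n\in V\}$ with $x_1,\ldots,x_n\in F$; "quasicompact" refers to this topology (every open cover has a finite subcover). A rank one valuation ring is a valuation ring of Krull dimension one. $\mathfrak{M}_V$ denotes the maximal ideal of a valuation ring $V$. For nonempty $X\subseteq\mathrm{Zar}(F)$, $A(X)=\bigcap_{V\in X}V$ and $J(X)=\bigcap_{V\in X}\mathfrak{M}_V$. For a ring $A$, $\mathrm{Max}(A)$ is its set of maximal ideals. A Prüfer domain is an integral domain $A$ such that $A_M$ is a valuation domain for each maximal ideal $M$ of $A$; one-dimensional means of Krull dimension one. The domains $A$ with quotient field $F$ are taken as subrings of $F$, and their localizations $A_M$ are taken inside $F$. *)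

theory Defs
  imports
    "HOL-Algebra.Ideal"
    "HOL-Algebra.Subrings"
    "HOL-Analysis.Abstract_Topology"
    "HOL-Library.Extended_Nat"
begin

text \<open>A subring \<open>A\<close> of a ring \<open>F\<close>, regarded as a ring in its own right, is
  \<open>F\<lparr>carrier := A\<rparr>\<close>.\<close>

text \<open>Supremum of the lengths \<open>n\<close> of chains \<open>P 0 \<subset> P 1 \<subset> \<dots> \<subset> P n\<close> of prime ideals.
  The zero ring gets dimension 0 here; only nonzero rings are considered below.\<close>

definition krull_dim :: "('a, 'b) ring_scheme \<Rightarrow> enat" where
  "krull_dim R =
     (SUP n \<in> {n. \<exists>P :: nat \<Rightarrow> 'a set.
                   (\<forall>i\<le>n. primeideal (P i) R) \<and> (\<forall>i<n. P i \<subset> P (Suc i))}. enat n)"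

definition Max_ideals :: "('a, 'b) ring_scheme \<Rightarrow> 'a set set" where
  "Max_ideals R = {M. maximalideal M R}"

definition jacobson_radical :: "('a, 'b) ring_scheme \<Rightarrow> 'a set" where
  "jacobson_radical R = \<Inter> (Max_ideals R)"

definition quotient_field_in :: "('a, 'b) ring_scheme \<Rightarrow> 'a set \<Rightarrow> 'a set" where
  "quotient_field_in F A = {a \<otimes>\<^bsub>F\<^esub> inv\<^bsub>F\<^esub> s | a s. a \<in> A \<and> s \<in> A - {\<zero>\<^bsub>F\<^esub>}}"

definition localization_in :: "('a, 'b) ring_scheme \<Rightarrow> 'a set \<Rightarrow> 'a set \<Rightarrow> 'a set" where
  "localization_in F A P = {a \<otimes>\<^bsub>F\<^esub> inv\<^bsub>F\<^esub> s | a s. a \<in> A \<and> s \<in> A - P}"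

definition Zar :: "('a, 'b) ring_scheme \<Rightarrow> 'a set set" where
  "Zar F = {V. subring V F \<and>
               (\<forall>t \<in> carrier F - {\<zero>\<^bsub>F\<^esub>}. t \<in> V \<or> inv\<^bsub>F\<^esub> t \<in> V)}"

definition rank_one_valuation_rings :: "('a, 'b) ring_scheme \<Rightarrow> 'a set set" where
  "rank_one_valuation_rings F = {V \<in> Zar F. krull_dim (F\<lparr>carrier := V\<rparr>) = 1}"

definition zariski_basis :: "('a, 'b) ring_scheme \<Rightarrow> 'a set set set" where
  "zariski_basis F = {{V \<in> Zar F. S \<subseteq> V} | S. finite S \<and> S \<subseteq> carrier F}"

definition zariski_topology :: "('a, 'b) ring_scheme \<Rightarrow> 'a set topology" where
  "zariski_topology F = topology (arbitrary union_of (\<lambda>U. U \<in> zariski_basis F))"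

lemma openin_zariski_topology:
  "openin (zariski_topology F) = arbitrary union_of (\<lambda>U. U \<in> zariski_basis F)"
proof -
  have "istopology (arbitrary union_of (\<lambda>U. U \<in> zariski_basis F))"
  proof (rule istopology_base)
    fix U W
    assume "U \<in> zariski_basis F" and "W \<in> zariski_basis F"
    then obtain S T where
      "U = {V \<in> Zar F. S \<subseteq> V}" "finite S" "S \<subseteq> carrier F"
      "W = {V \<in> Zar F. T \<subseteq> V}" "finite T" "T \<subseteq> carrier F"
      unfolding zariski_basis_def by blast
    moreover from this have "U \<inter> W = {V \<in> Zar F. S \<union> T \<subseteq> V}"
      by blast
    ultimately show "U \<inter> W \<in> zariski_basis F"
      unfolding zariski_basis_def by (blast intro: finite_UnI)
  qed
  then show ?thesis
    by (simp add: zariski_topology_def topology_inverse')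
qed

lemma topspace_zariski_topology: "topspace (zariski_topology F) = Zar F"
proof
  show "topspace (zariski_topology F) \<subseteq> Zar F"
  proof
    fix V
    assume "V \<in> topspace (zariski_topology F)"
    then obtain U where "openin (zariski_topology F) U" "V \<in> U"
      unfolding topspace_def by blast
    then show "V \<in> Zar F"
      by (auto simp: openin_zariski_topology union_of_def zariski_basis_def)
  qed
  have "Zar F \<in> zariski_basis F"
    unfolding zariski_basis_def by (rule CollectI, rule exI[of _ "{}"]) simp
  then have "openin (zariski_topology F) (Zar F)"
    by (simp add: openin_zariski_topology arbitrary_union_of_inc)
  then show "Zar F \<subseteq> topspace (zariski_topology F)"
    by (rule openin_subset)
qed

definition val_max_ideal :: "('a, 'b) ring_scheme \<Rightarrow> 'a set \<Rightarrow> 'a set" where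
  "val_max_ideal F V = (THE M. maximalideal M (F\<lparr>carrier := V\<rparr>))"

lemma maximalideal_valuation_ring_iff:
  assumes F: "field F" and V: "V \<in> Zar F"
  shows "maximalideal M (F\<lparr>carrier := V\<rparr>) \<longleftrightarrow> M = {x \<in> V. x = \<zero>\<^bsub>F\<^esub> \<or> inv\<^bsub>F\<^esub> x \<notin> V}"
proof -
  interpret field F by (rule F)
  let ?R = "F\<lparr>carrier := V\<rparr>"
  define N where "N = {x \<in> V. x = \<zero>\<^bsub>F\<^esub> \<or> inv\<^bsub>F\<^esub> x \<notin> V}"
  have sub: "subring V F" and val: "\<And>t. t \<in> carrier F \<Longrightarrow> t \<noteq> \<zero>\<^bsub>F\<^esub> \<Longrightarrow> t \<in> V \<or> inv\<^bsub>F\<^esub> t \<in> V"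
    using V by (auto simp: Zar_def)
  note VE = subringE[OF sub]
  have VF: "x \<in> carrier F" if "x \<in> V" for x using that VE(1) by blast
  have R: "ring ?R" by (rule subring_is_ring[OF sub])
  have unit: "x \<otimes>\<^bsub>F\<^esub> inv\<^bsub>F\<^esub> x = \<one>\<^bsub>F\<^esub>" "inv\<^bsub>F\<^esub> x \<in> carrier F" "inv\<^bsub>F\<^esub> x \<noteq> \<zero>\<^bsub>F\<^esub>"
    if "x \<in> carrier F" "x \<noteq> \<zero>\<^bsub>F\<^esub>" for x
    using that field_Units by (auto simp: Units_r_inv)
  have mul: "v \<otimes>\<^bsub>F\<^esub> x \<in> N" if v: "v \<in> V" and x: "x \<in> N" for v x
  proof -
    have xV: "x \<in> V" using x by (simp add: N_def)
    have False if nz: "v \<otimes>\<^bsub>F\<^esub> x \<noteq> \<zero>\<^bsub>F\<^esub>" and i: "inv\<^bsub>F\<^esub> (v \<otimes>\<^bsub>F\<^esub> x) \<in> V"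
    proof -
      have vx: "v \<noteq> \<zero>\<^bsub>F\<^esub>" "x \<noteq> \<zero>\<^bsub>F\<^esub>" using nz VF[OF v] VF[OF xV] by auto
      let ?w = "inv\<^bsub>F\<^esub> (v \<otimes>\<^bsub>F\<^esub> x)"
      have "(v \<otimes>\<^bsub>F\<^esub> x) \<otimes>\<^bsub>F\<^esub> ?w = \<one>\<^bsub>F\<^esub>"
        using unit(1) nz VF[OF v] VF[OF xV] by simp
      then have "x \<otimes>\<^bsub>F\<^esub> (v \<otimes>\<^bsub>F\<^esub> ?w) = \<one>\<^bsub>F\<^esub>"
        using VF[OF v] VF[OF xV] VF[OF i] by (simp add: m_ac)
      then have "inv\<^bsub>F\<^esub> x = v \<otimes>\<^bsub>F\<^esub> ?w"
        using comm_inv_char VF[OF v] VF[OF xV] VF[OF i] by blast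
      then have "inv\<^bsub>F\<^esub> x \<in> V" using VE(6)[OF v i] by simp
      then show False using x vx by (simp add: N_def)
    qed
    then show ?thesis using VE(6)[OF v xV] by (auto simp: N_def)
  qed
  have mul': "x \<otimes>\<^bsub>F\<^esub> v \<in> N" if "v \<in> V" "x \<in> N" for v x
    using mul[OF that] that VF by (simp add: N_def m_comm)
  have aux: "x \<oplus>\<^bsub>F\<^esub> y \<in> N"
    if x: "x \<in> N" and y: "y \<in> N" and y0: "y \<noteq> \<zero>\<^bsub>F\<^esub>" and t: "x \<otimes>\<^bsub>F\<^esub> inv\<^bsub>F\<^esub> y \<in> V" for x y
  proof -
    have xy: "x \<in> carrier F" "y \<in> carrier F" using x y VF by (auto simp: N_def)
    have "(x \<otimes>\<^bsub>F\<^esub> inv\<^bsub>F\<^esub> y \<oplus>\<^bsub>F\<^esub> \<one>\<^bsub>F\<^esub>) \<otimes>\<^bsub>F\<^esub> y \<in> N"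
      by (rule mul[OF VE(7)[OF t VE(3)] y])
    moreover have "(x \<otimes>\<^bsub>F\<^esub> inv\<^bsub>F\<^esub> y \<oplus>\<^bsub>F\<^esub> \<one>\<^bsub>F\<^esub>) \<otimes>\<^bsub>F\<^esub> y = x \<oplus>\<^bsub>F\<^esub> y"
      using xy unit[OF xy(2) y0] by (simp add: l_distr m_assoc m_comm[of "inv\<^bsub>F\<^esub> y" y])
    ultimately show ?thesis by simp
  qed
  have add: "x \<oplus>\<^bsub>F\<^esub> y \<in> N" if x: "x \<in> N" and y: "y \<in> N" for x y
  proof -
    have xy: "x \<in> carrier F" "y \<in> carrier F" using x y VF by (auto simp: N_def)
    show ?thesis
    proof (cases "x = \<zero>\<^bsub>F\<^esub> \<or> y = \<zero>\<^bsub>F\<^esub>")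
      case True then show ?thesis using x y xy by auto
    next
      case False
      note ux = unit[OF xy(1)] and uy = unit[OF xy(2)]
      let ?t = "x \<otimes>\<^bsub>F\<^esub> inv\<^bsub>F\<^esub> y"
      have t: "?t \<in> carrier F" "?t \<noteq> \<zero>\<^bsub>F\<^esub>" using False ux uy xy by (auto simp: integral_iff)
      have "?t \<otimes>\<^bsub>F\<^esub> (y \<otimes>\<^bsub>F\<^esub> inv\<^bsub>F\<^esub> x) = (x \<otimes>\<^bsub>F\<^esub> inv\<^bsub>F\<^esub> x) \<otimes>\<^bsub>F\<^esub> (y \<otimes>\<^bsub>F\<^esub> inv\<^bsub>F\<^esub> y)"
        using False xy ux(2) uy(2) by (simp add: m_ac)
      also have "\<dots> = \<one>\<^bsub>F\<^esub>" using False ux(1) uy(1) by simp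
      finally have "inv\<^bsub>F\<^esub> ?t = y \<otimes>\<^bsub>F\<^esub> inv\<^bsub>F\<^esub> x"
        using comm_inv_char[OF t(1)] False xy ux(2) by blast
      then consider "?t \<in> V" | "y \<otimes>\<^bsub>F\<^esub> inv\<^bsub>F\<^esub> x \<in> V"
        using val[OF t] by metis
      then show ?thesis
      proof cases
        case 1
        then show ?thesis using aux[OF x y] False by blast
      next
        case 2
        then show ?thesis using aux[OF y x] False a_comm[OF xy] by metis
      qed
    qed
  qed
  have neg: "\<ominus>\<^bsub>F\<^esub> x \<in> N" if x: "x \<in> N" for x
    using mul[OF VE(5)[OF VE(3)] x] x VF by (simp add: N_def l_minus)
  have NV: "N \<subseteq> V" by (auto simp: N_def)
  have "subgroup N (add_monoid F)"
    by (rule add.subgroupI) (use NV VE VF add neg in \<open>auto simp: N_def a_inv_def\<close>)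
  then have "subgroup N (add_monoid ?R)"
    using add.subgroup_incl[OF _ subring.axioms(1)[OF sub] NV] by simp
  then have ideal: "ideal N ?R"
    by (intro idealI R) (auto intro: mul mul')
  have one: "\<one>\<^bsub>F\<^esub> \<notin> N" using VE(3) by (simp add: N_def)
  have sup: "J = V" if J: "ideal J ?R" and x: "x \<in> J" "x \<notin> N" for J x
  proof -
    interpret J: ideal J ?R by (rule J)
    have xV: "x \<in> V" using J.a_subset x(1) by auto
    then have "x \<noteq> \<zero>\<^bsub>F\<^esub>" "inv\<^bsub>F\<^esub> x \<in> V" using x(2) by (auto simp: N_def)
    then have "\<one>\<^bsub>F\<^esub> \<in> J"
      using J.I_r_closed[OF x(1), of "inv\<^bsub>F\<^esub> x"] unit VF[OF xV] by simp
    then show ?thesis using J.one_imp_carrier by simp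
  qed
  show ?thesis
    unfolding N_def[symmetric]
  proof
    assume "maximalideal M ?R"
    then interpret M: maximalideal M ?R .
    have "M \<subseteq> N" using sup[OF M.ideal_axioms] M.I_notcarr by auto
    then show "M = N" using M.I_maximal[OF ideal] NV one VE(3) by auto
  next
    assume "M = N"
    then show "maximalideal M ?R"
      using ideal sup one VE(3) by (intro maximalidealI) auto
  qed
qed

lemma maximalideal_val_max_ideal:
  assumes "field F" and "V \<in> Zar F"
  shows "maximalideal (val_max_ideal F V) (F\<lparr>carrier := V\<rparr>)"
  unfolding val_max_ideal_def maximalideal_valuation_ring_iff[OF assms] by simp

text \<open>The next two are used only for nonempty \<open>X\<close> (both give \<open>UNIV\<close> for the empty set).\<close>

definition val_Inter :: "'a set set \<Rightarrow> 'a set" where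
  "val_Inter X = (\<Inter>V\<in>X. V)"

definition val_max_Inter :: "('a, 'b) ring_scheme \<Rightarrow> 'a set set \<Rightarrow> 'a set" where
  "val_max_Inter F X = (\<Inter>V\<in>X. val_max_ideal F V)"

text \<open>A valuation domain is a valuation ring of its own quotient field; the latter is formed
  inside \<open>F\<close>, and need not be all of \<open>F\<close>.\<close>

definition valuation_domain_in :: "('a, 'b) ring_scheme \<Rightarrow> 'a set \<Rightarrow> bool" where
  "valuation_domain_in F V \<longleftrightarrow> subdomain V F \<and>
     (\<forall>t \<in> quotient_field_in F V - {\<zero>\<^bsub>F\<^esub>}. t \<in> V \<or> inv\<^bsub>F\<^esub> t \<in> V)"

definition pruefer_domain_in :: "('a, 'b) ring_scheme \<Rightarrow> 'a set \<Rightarrow> bool" where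
  "pruefer_domain_in F A \<longleftrightarrow> subdomain A F \<and>
     (\<forall>M \<in> Max_ideals (F\<lparr>carrier := A\<rparr>). valuation_domain_in F (localization_in F A M))"

definition max_localizations :: "('a, 'b) ring_scheme \<Rightarrow> 'a set \<Rightarrow> 'a set set" where
  "max_localizations F A = localization_in F A ` Max_ideals (F\<lparr>carrier := A\<rparr>)"

definition qc_rank_one_sets :: "('a, 'b) ring_scheme \<Rightarrow> 'a set set set" where
  "qc_rank_one_sets F =
     {X. X \<noteq> {} \<and> X \<subseteq> rank_one_valuation_rings F \<and>
         compactin (zariski_topology F) X \<and> val_max_Inter F X \<noteq> {\<zero>\<^bsub>F\<^esub>}}"

definition one_dim_pruefer_domains :: "('a, 'b) ring_scheme \<Rightarrow> 'a set set" where
  "one_dim_pruefer_domains F =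
     {A. pruefer_domain_in F A \<and> krull_dim (F\<lparr>carrier := A\<rparr>) = 1 \<and>
         jacobson_radical (F\<lparr>carrier := A\<rparr>) \<noteq> {\<zero>\<^bsub>F\<^esub>} \<and>
         quotient_field_in F A = carrier F}"

end

theory Submission
  imports Defs "HOL-Algebra.Ring_Divisibility"
begin

text \<open>Let \<open>X\<close> be a quasicompact set of rank one valuation rings, \<open>A\<close> the intersection of its
  members, and \<open>j \<noteq> 0\<close> an element of all their maximal ideals. The key is a kind of partition of
  unity. For \<open>t \<noteq> 0\<close> in the field, put \<open>y = j t\<^sup>N\<^sup>+\<^sup>1\<close>, \<open>e = 1 / (1 + y)\<close> and \<open>f = 1 - e\<close>. In a member
  \<open>V\<close> that contains \<open>t\<close>, the element \<open>y\<close> lies in the maximal ideal, so \<open>e\<close> is congruent to 1. If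
  \<open>t\<close> is not in \<open>V\<close>, the pole of \<open>t\<^sup>N\<close> outweighs the zero of \<open>j\<close> as soon as \<open>N\<close> is large,
  because \<open>V\<close> has rank one; then \<open>y\<close> has its inverse in the maximal ideal, and \<open>e\<close> is congruent
  to 0. Quasicompactness makes one \<open>N\<close> work for all members at once. Hence \<open>e\<close> and \<open>f\<close> lie in
  \<open>A\<close>, have sum 1, and are congruent to 1 and 0, or to 0 and 1, according to whether
  \<open>t \<in> V\<close>; moreover \<open>e t\<close> and \<open>f t\<^sup>-\<^sup>1\<close> lie in \<open>A\<close> (lemma \<open>rank_one_partition\<close>).

  This has two consequences. If \<open>t \<in> V\<close>, then \<open>e t \<in> A\<close> with \<open>e\<close> a unit of \<open>V\<close>, so that \<open>V\<close>
  is the localization of \<open>A\<close> at its center, the contraction of its maximal ideal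
  (\<open>localization_center\<close>). And if \<open>a\<close> and \<open>b\<close> lie in an ideal of \<open>A\<close>, then, with \<open>t = a\<^sup>-\<^sup>1\<close>,
  the element \<open>e a + f b\<close> of this ideal is a unit in every \<open>V\<close> in which \<open>a\<close> or \<open>b\<close> is one
  (\<open>qc_unit_combination\<close>). By quasicompactness, an ideal contained in no center then contains an
  element that is a unit in every member of \<open>X\<close>, hence a unit of \<open>A\<close>. So every maximal ideal is
  a center (\<open>qc_maximal_has_center\<close>), and since there are no inclusions between distinct rank one
  valuation rings of the field, every center is maximal (\<open>center_maximal\<close>). The dimension and
  the quotient field of \<open>A\<close> come from the archimedean property of rank one.

  Conversely, let \<open>A\<close> be a one-dimensional Pruefer domain with nonzero Jacobson radical. Its
  localizations at maximal ideals are valuation rings of the field because \<open>A\<close> has this quotient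
  field, they have rank one because chains of primes contract to \<open>A\<close>, and their intersection
  is \<open>A\<close>. They form a quasicompact set for the same reason that the maximal spectrum is
  quasicompact (\<open>compactin_max_localizations\<close>).\<close>

section \<open>Prime ideals and Krull dimension\<close>

text \<open>A chain of primes can be truncated, so a dimension is 1 as soon as it is attained by a chain
  of length 1 and there is none of length 2.\<close>

lemma krull_dim_eq_one_iff:
  "krull_dim R = 1 \<longleftrightarrow>
     (\<exists>P Q. primeideal P R \<and> primeideal Q R \<and> P \<subset> Q) \<and>
     \<not> (\<exists>P Q S. primeideal P R \<and> primeideal Q R \<and> primeideal S R \<and> P \<subset> Q \<and> Q \<subset> S)"
  (is "_ \<longleftrightarrow> ?one \<and> \<not> ?two")
proof -
  define C where "C = {n. \<exists>P :: nat \<Rightarrow> _ set.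
    (\<forall>i\<le>n. primeideal (P i) R) \<and> (\<forall>i<n. P i \<subset> P (Suc i))}"
  have dim: "krull_dim R = (SUP n\<in>C. enat n)"
    by (simp add: krull_dim_def C_def)
  have le: "m \<in> C" if "n \<in> C" "m \<le> n" for m n
  proof -
    obtain P where P: "\<forall>i\<le>n. primeideal (P i) R" "\<forall>i<n. P i \<subset> P (Suc i)"
      using \<open>n \<in> C\<close> unfolding C_def by blast
    have "(\<forall>i\<le>m. primeideal (P i) R) \<and> (\<forall>i<m. P i \<subset> P (Suc i))"
      using P \<open>m \<le> n\<close> by auto
    then show ?thesis unfolding C_def by blast
  qed
  have one: "1 \<in> C \<longleftrightarrow> ?one"
  proof
    assume "1 \<in> C"
    then obtain P where "\<forall>i\<le>1. primeideal (P i) R" "\<forall>i<1. P i \<subset> P (Suc i)"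
      unfolding C_def by blast
    then have "primeideal (P 0) R" "primeideal (P 1) R" "P 0 \<subset> P 1" by auto
    then show ?one by blast
  next
    assume ?one
    then obtain P Q where "primeideal P R" "primeideal Q R" "P \<subset> Q" by blast
    then show "1 \<in> C"
      unfolding C_def by (intro CollectI exI[of _ "\<lambda>i. if i = 0 then P else Q"]) auto
  qed
  have two: "2 \<in> C \<longleftrightarrow> ?two"
  proof
    assume "2 \<in> C"
    then obtain P where P: "\<forall>i\<le>2. primeideal (P i) R" "\<forall>i<2. P i \<subset> P (Suc i)"
      unfolding C_def by blast
    have "primeideal (P 0) R" "primeideal (P 1) R" "primeideal (P 2) R" "P 0 \<subset> P 1" "P 1 \<subset> P 2"
      using P(1) P(2)[rule_format, of 0] P(2)[rule_format, of 1] by (auto simp: numeral_2_eq_2)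
    then show ?two by blast
  next
    assume ?two
    then obtain P Q S where "primeideal P R" "primeideal Q R" "primeideal S R" "P \<subset> Q" "Q \<subset> S"
      by blast
    then show "2 \<in> C"
      unfolding C_def
      by (intro CollectI exI[of _ "\<lambda>i. if i = 0 then P else if i = 1 then Q else S"]) auto
  qed
  have "krull_dim R = 1 \<longleftrightarrow> 1 \<in> C \<and> 2 \<notin> C"
  proof
    assume d: "krull_dim R = 1"
    have "enat n \<le> 1" if "n \<in> C" for n
      using SUP_upper[OF that, of enat] d dim by simp
    then have "n \<le> 1" if "n \<in> C" for n
      using that by (auto simp: one_enat_def)
    then have "2 \<notin> C" by force
    moreover have "1 \<in> C"
    proof (rule ccontr)
      assume "1 \<notin> C"
      then have "enat n \<le> 0" if "n \<in> C" for n
        using le[OF that, of 1] by (cases n) (auto simp: zero_enat_def)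
      then have "krull_dim R \<le> 0" unfolding dim by (rule SUP_least)
      then show False using d by simp
    qed
    ultimately show "1 \<in> C \<and> 2 \<notin> C" by simp
  next
    assume c: "1 \<in> C \<and> 2 \<notin> C"
    have "n \<le> 1" if "n \<in> C" for n
      using le[OF that, of 2] c by linarith
    then have "krull_dim R \<le> 1"
      unfolding dim by (intro SUP_least) (simp add: one_enat_def)
    moreover have "1 \<le> krull_dim R"
      unfolding dim using c by (intro SUP_upper2[of 1]) (auto simp: one_enat_def)
    ultimately show "krull_dim R = 1" by simp
  qed
  then show ?thesis unfolding one two .
qed

lemma (in ring) exists_maximal_ideal_above:
  assumes I: "ideal I R" and one: "\<one> \<notin> I"
  obtains M where "maximalideal M R" "I \<subseteq> M"
proof -
  define S where "S = {J. ideal J R \<and> I \<subseteq> J \<and> \<one> \<notin> J}"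
  have "\<exists>M\<in>S. \<forall>J\<in>S. M \<subseteq> J \<longrightarrow> J = M"
  proof (rule subset_Zorn_nonempty)
    show "S \<noteq> {}" using I one by (auto simp: S_def)
    fix C assume C: "C \<noteq> {}" "subset.chain S C"
    then have "ideal (if C = {} then {\<zero>} else \<Union>C) R"
      by (intro chain_Union_is_ideal) (auto simp: S_def subset_chain_def)
    then show "\<Union>C \<in> S"
      using C by (auto simp: S_def subset_chain_def)
  qed
  then obtain M where M: "M \<in> S" "\<And>J. J \<in> S \<Longrightarrow> M \<subseteq> J \<Longrightarrow> J = M" by blast
  have "maximalideal M R"
  proof (rule maximalidealI)
    show "ideal M R" using M by (simp add: S_def)
    show "carrier R \<noteq> M" using M by (auto simp: S_def)
    fix J assume J: "ideal J R" "M \<subseteq> J" "J \<subseteq> carrier R"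
    show "J = M \<or> J = carrier R"
    proof (cases "\<one> \<in> J")
      case True
      then show ?thesis using ideal.one_imp_carrier[OF J(1)] by simp
    next
      case False
      then show ?thesis using M J by (auto simp: S_def)
    qed
  qed
  then show ?thesis using that M by (auto simp: S_def)
qed

lemma (in ring) subring_max_ideal_above:
  assumes A: "subring A R" and I: "ideal I (R\<lparr>carrier := A\<rparr>)" and one: "\<one> \<notin> I"
  obtains M where "maximalideal M (R\<lparr>carrier := A\<rparr>)" "I \<subseteq> M"
  using ring.exists_maximal_ideal_above[OF subring_is_ring[OF A] I] one by auto

lemma (in cring) ideal_subring_iff:
  assumes A: "subring A R"
  shows "ideal I (R\<lparr>carrier := A\<rparr>) \<longleftrightarrow>
    I \<subseteq> A \<and> \<zero> \<in> I \<and> (\<forall>x\<in>I. \<forall>y\<in>I. x \<oplus> y \<in> I) \<and> (\<forall>a\<in>A. \<forall>x\<in>I. a \<otimes> x \<in> I)"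
proof
  assume "ideal I (R\<lparr>carrier := A\<rparr>)"
  then interpret I: ideal I "R\<lparr>carrier := A\<rparr>" .
  show "I \<subseteq> A \<and> \<zero> \<in> I \<and> (\<forall>x\<in>I. \<forall>y\<in>I. x \<oplus> y \<in> I) \<and> (\<forall>a\<in>A. \<forall>x\<in>I. a \<otimes> x \<in> I)"
    using I.a_subset additive_subgroup.zero_closed[OF I.additive_subgroup_axioms]
      additive_subgroup.a_closed[OF I.additive_subgroup_axioms] I.I_l_closed by auto
next
  assume I: "I \<subseteq> A \<and> \<zero> \<in> I \<and> (\<forall>x\<in>I. \<forall>y\<in>I. x \<oplus> y \<in> I) \<and> (\<forall>a\<in>A. \<forall>x\<in>I. a \<otimes> x \<in> I)"
  note AE = subringE[OF A]
  have IR: "I \<subseteq> carrier R" using I AE(1) by blast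
  have neg: "\<ominus> x \<in> I" if "x \<in> I" for x
  proof -
    have "\<ominus> \<one> \<otimes> x \<in> I" using I AE(5)[OF AE(3)] that by blast
    then show ?thesis using that IR by (auto simp: l_minus)
  qed
  have "subgroup I (add_monoid R)"
    by (rule add.subgroupI) (use I IR neg in \<open>auto simp: a_inv_def\<close>)
  then have "subgroup I (add_monoid (R\<lparr>carrier := A\<rparr>))"
    using add.subgroup_incl[OF _ subring.axioms(1)[OF A]] I by simp
  moreover have "x \<otimes> a \<in> I" if "x \<in> I" "a \<in> A" for a x
  proof -
    have "x \<otimes> a = a \<otimes> x" using that IR AE(1) by (intro m_comm) auto
    then show ?thesis using I that by simp
  qed
  ultimately show "ideal I (R\<lparr>carrier := A\<rparr>)"
    using I by (intro idealI subring_is_ring A) auto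
qed

lemma (in cring) primeideal_subring_iff:
  assumes A: "subring A R"
  shows "primeideal P (R\<lparr>carrier := A\<rparr>) \<longleftrightarrow>
    ideal P (R\<lparr>carrier := A\<rparr>) \<and> \<one> \<notin> P \<and>
    (\<forall>a\<in>A. \<forall>b\<in>A. a \<otimes> b \<in> P \<longrightarrow> a \<in> P \<or> b \<in> P)"
proof
  assume "primeideal P (R\<lparr>carrier := A\<rparr>)"
  then interpret P: primeideal P "R\<lparr>carrier := A\<rparr>" .
  have "\<one> \<notin> P" using P.one_imp_carrier P.I_notcarr by auto
  then show "ideal P (R\<lparr>carrier := A\<rparr>) \<and> \<one> \<notin> P \<and>
    (\<forall>a\<in>A. \<forall>b\<in>A. a \<otimes> b \<in> P \<longrightarrow> a \<in> P \<or> b \<in> P)"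
    using P.ideal_axioms P.I_prime by auto
next
  assume P: "ideal P (R\<lparr>carrier := A\<rparr>) \<and> \<one> \<notin> P \<and>
    (\<forall>a\<in>A. \<forall>b\<in>A. a \<otimes> b \<in> P \<longrightarrow> a \<in> P \<or> b \<in> P)"
  have "cring (R\<lparr>carrier := A\<rparr>)"
    using subcringI'[OF A] subcring_iff subringE(1)[OF A] by blast
  then show "primeideal P (R\<lparr>carrier := A\<rparr>)"
    using P subringE(3)[OF A] by (intro primeidealI) auto
qed

lemma (in cring) primeideal_subringD:
  assumes A: "subring A R" and P: "primeideal P (R\<lparr>carrier := A\<rparr>)"
  shows "P \<subseteq> A" "\<zero> \<in> P" "\<one> \<notin> P"
    "x \<in> P \<Longrightarrow> y \<in> P \<Longrightarrow> x \<oplus> y \<in> P"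
    "a \<in> A \<Longrightarrow> x \<in> P \<Longrightarrow> a \<otimes> x \<in> P"
    "a \<in> A \<Longrightarrow> b \<in> A \<Longrightarrow> a \<otimes> b \<in> P \<Longrightarrow> a \<in> P \<or> b \<in> P"
  using P unfolding primeideal_subring_iff[OF A] ideal_subring_iff[OF A] by auto

lemma (in cring) primeideal_subringI:
  assumes A: "subring A R" and "P \<subseteq> A" "\<zero> \<in> P" "\<one> \<notin> P"
    "\<And>x y. x \<in> P \<Longrightarrow> y \<in> P \<Longrightarrow> x \<oplus> y \<in> P"
    "\<And>a x. a \<in> A \<Longrightarrow> x \<in> P \<Longrightarrow> a \<otimes> x \<in> P"
    "\<And>a b. a \<in> A \<Longrightarrow> b \<in> A \<Longrightarrow> a \<otimes> b \<in> P \<Longrightarrow> a \<in> P \<or> b \<in> P"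
  shows "primeideal P (R\<lparr>carrier := A\<rparr>)"
  unfolding primeideal_subring_iff[OF A] ideal_subring_iff[OF A]
  using assms(2,3,4) by (intro conjI ballI impI) (rule assms(5-7); assumption | simp)+

lemma (in cring) primeideal_contract:
  assumes A: "subring A R" and B: "subring B R" and AB: "A \<subseteq> B"
    and Q: "primeideal Q (R\<lparr>carrier := B\<rparr>)"
  shows "primeideal (Q \<inter> A) (R\<lparr>carrier := A\<rparr>)"
proof (rule primeideal_subringI[OF A])
  note QD = primeideal_subringD[OF B Q]
  show "\<zero> \<in> Q \<inter> A" "\<one> \<notin> Q \<inter> A" using QD(2,3) subringE(2)[OF A] by auto
  show "x \<oplus> y \<in> Q \<inter> A" if "x \<in> Q \<inter> A" "y \<in> Q \<inter> A" for x y
    using that QD(4)[of x y] subringE(7)[OF A, of x y] by simp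
  show "a \<otimes> x \<in> Q \<inter> A" if "a \<in> A" "x \<in> Q \<inter> A" for a x
    using that QD(5)[of a x] subringE(6)[OF A, of a x] AB by auto
  show "a \<in> Q \<inter> A \<or> b \<in> Q \<inter> A" if "a \<in> A" "b \<in> A" "a \<otimes> b \<in> Q \<inter> A" for a b
    using that QD(6)[of a b] AB by auto
qed simp

lemma (in cring) maximal_imp_primeideal_subring:
  assumes A: "subring A R" and M: "maximalideal M (R\<lparr>carrier := A\<rparr>)"
  shows "primeideal M (R\<lparr>carrier := A\<rparr>)"
proof -
  have "cring (R\<lparr>carrier := A\<rparr>)"
    using subcringI'[OF A] subcring_iff subringE(1)[OF A] by blast
  then show ?thesis using M by (rule cring.maximalideal_prime)
qed

lemma (in domain) primeideal_zero_subring: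
  assumes A: "subring A R"
  shows "primeideal {\<zero>} (R\<lparr>carrier := A\<rparr>)"
  unfolding primeideal_subring_iff[OF A] ideal_subring_iff[OF A]
  using subringE[OF A] integral by (auto simp: subset_iff)


section \<open>Valuation rings of a field\<close>

context field
begin

lemma inv_props:
  assumes "x \<in> carrier R" "x \<noteq> \<zero>"
  shows "inv x \<in> carrier R" "inv x \<noteq> \<zero>" "x \<otimes> inv x = \<one>" "inv x \<otimes> x = \<one>" "inv (inv x) = x"
  using assms field_Units by auto

lemma inv_mult:
  assumes "x \<in> carrier R" "x \<noteq> \<zero>" "y \<in> carrier R" "y \<noteq> \<zero>"
  shows "inv (x \<otimes> y) = inv x \<otimes> inv y"
proof (rule comm_inv_char)
  note p = inv_props[OF assms(1,2)] inv_props[OF assms(3,4)]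
  have "x \<otimes> y \<otimes> (inv x \<otimes> inv y) = (x \<otimes> inv x) \<otimes> (y \<otimes> inv y)"
    using assms p(1,6) by (simp add: m_ac)
  then show "x \<otimes> y \<otimes> (inv x \<otimes> inv y) = \<one>" using p(3,8) by simp
qed (use assms inv_props in auto)

lemma inv_pow:
  assumes "x \<in> carrier R" "x \<noteq> \<zero>"
  shows "inv (x [^] (n::nat)) = inv x [^] n"
proof (rule comm_inv_char)
  show "x [^] n \<otimes> inv x [^] n = \<one>"
    using nat_pow_distrib[of x "inv x" n] assms inv_props[OF assms] by simp
qed (use assms inv_props in auto)

lemma pow_nonzero: "x \<in> carrier R \<Longrightarrow> x \<noteq> \<zero> \<Longrightarrow> x [^] (n::nat) \<noteq> \<zero>"
  by (induction n) (auto simp: integral_iff)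

lemma Zar_subring: "V \<in> Zar R \<Longrightarrow> subring V R"
  by (simp add: Zar_def)

lemma Zar_cases: "V \<in> Zar R \<Longrightarrow> t \<in> carrier R \<Longrightarrow> t \<noteq> \<zero> \<Longrightarrow> t \<in> V \<or> inv t \<in> V"
  by (simp add: Zar_def)

lemma val_max_ideal_eq:
  assumes "V \<in> Zar R"
  shows "val_max_ideal R V = {x \<in> V. x = \<zero> \<or> inv x \<notin> V}"
  using maximalideal_val_max_ideal[OF field_axioms assms]
    maximalideal_valuation_ring_iff[OF field_axioms assms] by blast

lemma val_max_ideal_prime:
  assumes "V \<in> Zar R"
  shows "primeideal (val_max_ideal R V) (R\<lparr>carrier := V\<rparr>)"
  using maximal_imp_primeideal_subring[OF Zar_subring maximalideal_val_max_ideal] assms field_axioms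
  by blast

lemmas val_max_idealD = primeideal_subringD[OF Zar_subring val_max_ideal_prime]

lemma inv_in_val_max_ideal:
  assumes "V \<in> Zar R" "t \<in> carrier R" "t \<notin> V"
  shows "t \<noteq> \<zero>" "inv t \<in> val_max_ideal R V"
proof -
  show t0: "t \<noteq> \<zero>" using assms subringE(2)[OF Zar_subring] by blast
  then show "inv t \<in> val_max_ideal R V"
    using assms Zar_cases inv_props[of t] by (auto simp: val_max_ideal_eq)
qed

lemma val_unit:
  assumes "V \<in> Zar R" "x \<in> V" "x \<notin> val_max_ideal R V"
  shows "x \<noteq> \<zero>" "inv x \<in> V"
  using assms by (auto simp: val_max_ideal_eq)

text \<open>Units stay units under perturbation by nonunits, as valuation rings are local.\<close>

lemma val_unit_add:
  assumes V: "V \<in> Zar R" and x: "x \<in> V" "x \<notin> val_max_ideal R V"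
    and m: "m \<in> val_max_ideal R V"
  shows "x \<oplus> m \<in> V" "x \<oplus> m \<notin> val_max_ideal R V"
proof -
  note VE = subringE[OF Zar_subring[OF V]] and M = val_max_idealD[OF V V]
  have c: "m \<in> V" "m \<in> carrier R" "x \<in> carrier R" using M(1) m x VE(1) by auto
  show "x \<oplus> m \<in> V" by (rule VE(7)[OF x(1) c(1)])
  show "x \<oplus> m \<notin> val_max_ideal R V"
  proof
    assume a: "x \<oplus> m \<in> val_max_ideal R V"
    have "\<ominus> \<one> \<otimes> m \<in> val_max_ideal R V" by (rule M(5)[OF VE(5)[OF VE(3)] m])
    then have "\<ominus> m \<in> val_max_ideal R V" using c by (simp add: l_minus)
    from M(4)[OF a this] have "x \<in> val_max_ideal R V"
      using c by (simp add: a_assoc r_neg)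
    then show False using x by simp
  qed
qed

text \<open>Otherwise the elements that are divisible by every power of \<open>a\<close> would form a prime ideal
  strictly between zero and the maximal ideal: it contains \<open>b\<^sup>-\<^sup>1\<close> but not \<open>a\<close>.\<close>

lemma rank_one_archimedean:
  assumes V: "V \<in> rank_one_valuation_rings R" and a: "a \<in> val_max_ideal R V"
    and b: "b \<in> carrier R"
  obtains n :: nat where "a [^] n \<otimes> b \<in> V"
proof (rule ccontr)
  have VZ: "V \<in> Zar R" and dim: "krull_dim (R\<lparr>carrier := V\<rparr>) = 1"
    using V by (auto simp: rank_one_valuation_rings_def)
  note sub = Zar_subring[OF VZ]
  note VE = subringE[OF sub] and M = val_max_idealD[OF VZ VZ]
  assume "\<not> thesis"
  then have neg: "a [^] n \<otimes> b \<notin> V" for n :: nat using that by blast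
  have aV: "a \<in> V" "a \<in> carrier R" using a M(1) VE(1) by auto
  have "a [^] (1::nat) \<otimes> b \<noteq> \<zero>" using neg[of 1] VE(2) by auto
  then have nz: "a \<noteq> \<zero>" "b \<noteq> \<zero>" using aV b by auto
  define d where "d = inv a"
  have d: "d \<in> carrier R" "d \<noteq> \<zero>" "d \<notin> V" "d \<otimes> a = \<one>"
    using inv_props[OF aV(2) nz(1)] a nz by (auto simp: d_def val_max_ideal_eq[OF VZ])
  define Q where "Q = {x \<in> carrier R. \<forall>n::nat. d [^] n \<otimes> x \<in> V}"
  have QV: "Q \<subseteq> V"
  proof
    fix x assume "x \<in> Q"
    then have "x \<in> carrier R" "d [^] (0::nat) \<otimes> x \<in> V" unfolding Q_def by blast+
    then show "x \<in> V" by simp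
  qed
  have Qid: "ideal Q (R\<lparr>carrier := V\<rparr>)"
    unfolding ideal_subring_iff[OF sub]
  proof (intro conjI ballI)
    show "Q \<subseteq> V" by (rule QV)
    show "\<zero> \<in> Q" using VE d by (auto simp: Q_def)
    show "x \<oplus> y \<in> Q" if "x \<in> Q" "y \<in> Q" for x y
      using that VE(7) d by (auto simp: Q_def r_distr)
    show "v \<otimes> x \<in> Q" if v: "v \<in> V" and x: "x \<in> Q" for v x
    proof -
      have vc: "v \<in> carrier R" "x \<in> carrier R" using v x VE(1) by (auto simp: Q_def)
      have "d [^] n \<otimes> (v \<otimes> x) = v \<otimes> (d [^] n \<otimes> x)" for n :: nat
        using vc d by (simp add: m_ac)
      then show ?thesis using v x vc VE(6) by (auto simp: Q_def)
    qed
  qed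
  have Qunit: "inv x \<notin> V" if "x \<in> Q" "x \<noteq> \<zero>" for x
  proof
    assume i: "inv x \<in> V"
    have x: "x \<in> carrier R" "d [^] (1::nat) \<otimes> x \<in> V" using that unfolding Q_def by blast+
    have "(d \<otimes> x) \<otimes> inv x \<in> V" using x i VE(6) d by simp
    then show False using inv_props[OF x(1) that(2)] x(1) d by (simp add: m_assoc)
  qed
  have "primeideal Q (R\<lparr>carrier := V\<rparr>)"
    unfolding primeideal_subring_iff[OF sub]
  proof (intro conjI ballI impI Qid)
    show "\<one> \<notin> Q" using Qunit[of \<one>] VE(3) by auto
    fix x y assume xy: "x \<in> V" "y \<in> V" "x \<otimes> y \<in> Q"
    then have xyc: "x \<in> carrier R" "y \<in> carrier R" using VE(1) by auto
    show "x \<in> Q \<or> y \<in> Q"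
    proof (rule ccontr)
      assume "\<not> (x \<in> Q \<or> y \<in> Q)"
      then obtain n m :: nat where nm: "d [^] n \<otimes> x \<notin> V" "d [^] m \<otimes> y \<notin> V"
        using xyc by (auto simp: Q_def)
      define u where "u = d [^] n \<otimes> x"
      define w where "w = d [^] m \<otimes> y"
      have uw: "u \<in> carrier R" "w \<in> carrier R" "u \<notin> V" "w \<notin> V"
        using nm xyc d by (auto simp: u_def w_def)
      have u0: "u \<noteq> \<zero>" and iu: "inv u \<in> V"
        using inv_in_val_max_ideal[OF VZ uw(1,3)] M(1) by auto
      have "u \<otimes> w = d [^] (n + m) \<otimes> (x \<otimes> y)"
        using xyc d by (simp add: u_def w_def m_ac flip: nat_pow_mult)
      then have "u \<otimes> w \<in> V" using xy(3) by (simp add: Q_def)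
      then have "inv u \<otimes> (u \<otimes> w) \<in> V" using iu VE(6) by blast
      then have "w \<in> V"
        using inv_props[OF uw(1) u0] uw by (simp flip: m_assoc)
      then show False using uw by simp
    qed
  qed
  moreover have "{\<zero>} \<subset> Q"
  proof -
    have "d [^] n \<otimes> inv b \<in> V" for n :: nat
    proof -
      have "a [^] n \<otimes> b \<in> carrier R" using aV b by simp
      then have "inv (a [^] n \<otimes> b) \<in> V"
        using inv_in_val_max_ideal[OF VZ _ neg] M(1) by blast
      then show ?thesis
        using inv_mult[of "a [^] n" b] inv_pow[OF aV(2) nz(1)] pow_nonzero[OF aV(2) nz(1)] aV b nz
        by (simp add: d_def)
    qed
    then have "inv b \<in> Q" "inv b \<noteq> \<zero>" using inv_props[OF b nz(2)] by (auto simp: Q_def)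
    moreover have "\<zero> \<in> Q" using d VE by (simp add: Q_def)
    ultimately show ?thesis by blast
  qed
  moreover have "Q \<subset> val_max_ideal R V"
  proof -
    have "Q \<subseteq> val_max_ideal R V"
      using QV Qunit by (auto simp: val_max_ideal_eq[OF VZ])
    moreover have "a \<notin> Q"
    proof
      assume "a \<in> Q"
      then have "d [^] (2::nat) \<otimes> a \<in> V" by (simp add: Q_def)
      then show False using d aV by (simp add: numeral_2_eq_2 m_assoc)
    qed
    ultimately show ?thesis using a by blast
  qed
  ultimately show False
    using dim primeideal_zero_subring[OF sub] val_max_ideal_prime[OF VZ]
    unfolding krull_dim_eq_one_iff by blast
qed


section \<open>Localizations inside the field\<close>

text \<open>A form without inverses: an element is in the localization when it has a denominator
  outside \<open>P\<close>.\<close>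

lemma localization_iff:
  assumes A: "subring A R" and P: "primeideal P (R\<lparr>carrier := A\<rparr>)"
  shows "x \<in> localization_in R A P \<longleftrightarrow> x \<in> carrier R \<and> (\<exists>s\<in>A - P. s \<otimes> x \<in> A)"
proof
  note AE = subringE[OF A] and PD = primeideal_subringD[OF A P]
  assume "x \<in> localization_in R A P"
  then obtain a s where as: "x = a \<otimes> inv s" "a \<in> A" "s \<in> A - P"
    unfolding localization_in_def by blast
  then have c: "a \<in> carrier R" "s \<in> carrier R" "s \<noteq> \<zero>" using AE(1) PD(2) by auto
  have "s \<otimes> x = a \<otimes> (s \<otimes> inv s)" using as c inv_props[OF c(2,3)] by (simp add: m_ac)
  also have "\<dots> = a" using c inv_props[OF c(2,3)] by simp
  finally have "s \<otimes> x \<in> A" using as(2) by simp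
  moreover have "x \<in> carrier R" using as(1) c inv_props(1)[OF c(2,3)] by simp
  ultimately show "x \<in> carrier R \<and> (\<exists>s\<in>A - P. s \<otimes> x \<in> A)" using as(3) by blast
next
  note AE = subringE[OF A] and PD = primeideal_subringD[OF A P]
  assume "x \<in> carrier R \<and> (\<exists>s\<in>A - P. s \<otimes> x \<in> A)"
  then obtain s where s: "x \<in> carrier R" "s \<in> A - P" "s \<otimes> x \<in> A" by blast
  then have c: "s \<in> carrier R" "s \<noteq> \<zero>" using AE(1) PD(2) by auto
  have "s \<otimes> x \<otimes> inv s = x \<otimes> (s \<otimes> inv s)" using s c inv_props(1)[OF c] by (simp add: m_ac)
  then have "x = (s \<otimes> x) \<otimes> inv s" using s inv_props[OF c] by simp
  then show "x \<in> localization_in R A P" using s unfolding localization_in_def by blast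
qed

lemma subset_localization:
  assumes A: "subring A R" and P: "primeideal P (R\<lparr>carrier := A\<rparr>)"
  shows "A \<subseteq> localization_in R A P"
proof
  fix x assume x: "x \<in> A"
  then have "x \<in> carrier R" "\<one> \<otimes> x \<in> A" using subringE(1)[OF A] by auto
  moreover have "\<one> \<in> A - P" using subringE(3)[OF A] primeideal_subringD(3)[OF A P] by simp
  ultimately show "x \<in> localization_in R A P" unfolding localization_iff[OF A P] by blast
qed

lemma localization_subring:
  assumes A: "subring A R" and P: "primeideal P (R\<lparr>carrier := A\<rparr>)"
  shows "subring (localization_in R A P) R"
proof (rule subringI)
  note AE = subringE[OF A] and PD = primeideal_subringD[OF A P] and loc = localization_iff[OF A P]
  show "localization_in R A P \<subseteq> carrier R" using loc by blast
  show "\<one> \<in> localization_in R A P" using subset_localization[OF A P] AE(3) by blast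
  fix x assume "x \<in> localization_in R A P"
  then obtain s where s: "x \<in> carrier R" "s \<in> A - P" "s \<otimes> x \<in> A" using loc by blast
  then have sc: "s \<in> carrier R" using AE(1) by blast
  have "s \<otimes> \<ominus> x \<in> A" using AE(5)[OF s(3)] s sc by (simp add: r_minus)
  then show "\<ominus> x \<in> localization_in R A P" using s loc by blast
  fix y assume "y \<in> localization_in R A P"
  then obtain r where r: "y \<in> carrier R" "r \<in> A - P" "r \<otimes> y \<in> A" using loc by blast
  then have rc: "r \<in> carrier R" using AE(1) by blast
  have sr: "s \<otimes> r \<in> A - P" using s r AE(6) PD(6) by blast
  have "s \<otimes> r \<otimes> (x \<otimes> y) = (s \<otimes> x) \<otimes> (r \<otimes> y)"
    using s r sc rc by (simp add: m_ac)
  then have "s \<otimes> r \<otimes> (x \<otimes> y) \<in> A" using AE(6) s r by simp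
  then show "x \<otimes> y \<in> localization_in R A P" using sr s r loc by blast
  have "s \<otimes> r \<otimes> (x \<oplus> y) = r \<otimes> (s \<otimes> x) \<oplus> s \<otimes> (r \<otimes> y)"
    using s r sc rc by (simp add: m_ac r_distr)
  then have "s \<otimes> r \<otimes> (x \<oplus> y) \<in> A" using AE(6,7) s r by simp
  then show "x \<oplus> y \<in> localization_in R A P" using sr s r loc by blast
qed

lemma localization_inv:
  assumes A: "subring A R" and P: "primeideal P (R\<lparr>carrier := A\<rparr>)" and s: "s \<in> A - P"
  shows "inv s \<in> localization_in R A P"
proof -
  have c: "s \<in> carrier R" "s \<noteq> \<zero>"
    using s subringE(1)[OF A] primeideal_subringD(2)[OF A P] by auto
  have "s \<otimes> inv s \<in> A" using inv_props(3)[OF c] subringE(3)[OF A] by simp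
  then show ?thesis
    using s inv_props(1)[OF c] unfolding localization_iff[OF A P] by blast
qed

text \<open>Clearing the denominator of an element of \<open>S - Q\<close> by a unit of the localization moves it
  into \<open>A\<close> without changing its membership in \<open>Q\<close> or \<open>S\<close>.\<close>

lemma localization_prime_strict_contract:
  assumes A: "subring A R" and P: "primeideal P (R\<lparr>carrier := A\<rparr>)"
    and Q: "primeideal Q (R\<lparr>carrier := localization_in R A P\<rparr>)"
    and S: "primeideal S (R\<lparr>carrier := localization_in R A P\<rparr>)" and QS: "Q \<subset> S"
  shows "Q \<inter> A \<subset> S \<inter> A"
proof -
  note sub = localization_subring[OF A P] and AL = subset_localization[OF A P]
  note QD = primeideal_subringD[OF sub Q] and SD = primeideal_subringD[OF sub S]
  obtain x where x: "x \<in> S" "x \<notin> Q" using QS by blast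
  then have xL: "x \<in> localization_in R A P" using SD(1) by blast
  then obtain s where s: "s \<in> A - P" "s \<otimes> x \<in> A" unfolding localization_iff[OF A P] by blast
  have c: "s \<in> carrier R" "s \<noteq> \<zero>"
    using s subringE(1)[OF A] primeideal_subringD(2)[OF A P] by auto
  have "s \<notin> Q"
    using QD(5)[OF localization_inv[OF A P s(1)], of s] inv_props[OF c] QD(3) by auto
  then have "s \<otimes> x \<notin> Q" using QD(6) x xL s AL by blast
  moreover have "s \<otimes> x \<in> S" using SD(5) x s AL by blast
  ultimately show ?thesis using QS s by blast
qed


section \<open>Quasicompact sets of rank one valuation rings\<close>

lemma zariski_finite_cover:
  assumes X: "compactin (zariski_topology R) X" and S: "S \<subseteq> carrier R"
    and cover: "\<And>V. V \<in> X \<Longrightarrow> \<exists>x\<in>S. x \<in> V"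
  obtains T where "finite T" "T \<subseteq> S" "\<And>V. V \<in> X \<Longrightarrow> \<exists>x\<in>T. x \<in> V"
proof -
  let ?U = "\<lambda>x. {V \<in> Zar R. {x} \<subseteq> V}"
  have XZ: "X \<subseteq> Zar R"
    using compactin_subset_topspace[OF X] by (simp add: topspace_zariski_topology)
  have "openin (zariski_topology R) (?U x)" if "x \<in> S" for x
    using that S unfolding openin_zariski_topology zariski_basis_def
    by (intro arbitrary_union_of_inc) blast
  then have "\<exists>\<F>. finite \<F> \<and> \<F> \<subseteq> ?U ` S \<and> X \<subseteq> \<Union>\<F>"
    using XZ cover by (intro compactinD[OF X]) blast+
  then obtain \<F> where "finite \<F>" "\<F> \<subseteq> ?U ` S" "X \<subseteq> \<Union>\<F>" by blast
  then obtain T where "T \<subseteq> S" "finite T" "X \<subseteq> \<Union>(?U ` T)"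
    using finite_subset_image[of \<F> ?U S] by blast
  then show ?thesis using that[of T] by blast
qed

text \<open>In this form, quasicompactness gives a bound for exponents that is uniform on the members of
  \<open>X\<close> not containing \<open>t\<close>: the condition \<open>t \<in> V\<close> is itself one of the open sets of the cover.\<close>

lemma zariski_uniform_bound:
  fixes h :: "nat \<Rightarrow> 'a"
  assumes X: "compactin (zariski_topology R) X"
    and c: "t \<in> carrier R" "\<And>n. h n \<in> carrier R"
    and cover: "\<And>V. V \<in> X \<Longrightarrow> t \<in> V \<or> (\<exists>n. h n \<in> V)"
  obtains N where "\<And>V. V \<in> X \<Longrightarrow> t \<in> V \<or> (\<exists>n\<le>N. h n \<in> V)"
proof -
  obtain T where T: "finite T" "T \<subseteq> insert t (range h)" "\<And>V. V \<in> X \<Longrightarrow> \<exists>x\<in>T. x \<in> V"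
  proof (rule zariski_finite_cover[OF X, of "insert t (range h)"])
    show "insert t (range h) \<subseteq> carrier R" using c by auto
    show "\<exists>x\<in>insert t (range h). x \<in> V" if "V \<in> X" for V using cover[OF that] by auto
  qed blast
  have "finite (T - {t})" "T - {t} \<subseteq> h ` UNIV" using T by auto
  then obtain C where C: "finite C" "T - {t} = h ` C"
    by (meson finite_subset_image)
  then obtain N where N: "\<And>n. n \<in> C \<Longrightarrow> n \<le> N" by (meson finite_nat_set_iff_bounded_le)
  show ?thesis
  proof (rule that[of N])
    fix V assume "V \<in> X"
    then obtain x where x: "x \<in> T" "x \<in> V" using T(3) by blast
    show "t \<in> V \<or> (\<exists>n\<le>N. h n \<in> V)"
    proof (cases "x = t")
      case False
      then have "x \<in> h ` C" using x C(2) by blast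
      then obtain n where "n \<in> C" "x = h n" by blast
      then show ?thesis using N x by blast
    qed (use x in simp)
  qed
qed

lemma qc_rank_oneD:
  assumes "X \<in> qc_rank_one_sets R"
  shows "X \<noteq> {}" "V \<in> X \<Longrightarrow> V \<in> rank_one_valuation_rings R" "V \<in> X \<Longrightarrow> V \<in> Zar R"
    "compactin (zariski_topology R) X"
    "\<exists>j\<in>carrier R. j \<noteq> \<zero> \<and> (\<forall>V\<in>X. j \<in> val_max_ideal R V)"
proof -
  show X: "X \<noteq> {}" "compactin (zariski_topology R) X"
    using assms by (auto simp: qc_rank_one_sets_def)
  show "V \<in> rank_one_valuation_rings R" if "V \<in> X" for V
    using assms that by (auto simp: qc_rank_one_sets_def)
  then show Z: "V \<in> Zar R" if "V \<in> X" for V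
    using that by (auto simp: rank_one_valuation_rings_def)
  have "\<zero> \<in> val_max_Inter R X" "val_max_Inter R X \<noteq> {\<zero>}"
    using assms val_max_idealD(2)[OF Z Z]
    by (auto simp: qc_rank_one_sets_def val_max_Inter_def)
  then obtain j where j: "j \<in> val_max_Inter R X" "j \<noteq> \<zero>" by blast
  moreover obtain V where "V \<in> X" using X by blast
  ultimately have "j \<in> carrier R"
    using val_max_idealD(1)[OF Z Z] subringE(1)[OF Zar_subring[OF Z]]
    unfolding val_max_Inter_def by blast
  then show "\<exists>j\<in>carrier R. j \<noteq> \<zero> \<and> (\<forall>V\<in>X. j \<in> val_max_ideal R V)"
    using j by (auto simp: val_max_Inter_def)
qed

text \<open>The elements are \<open>e = 1 / (1 + j t\<^sup>N\<^sup>+\<^sup>1)\<close> and \<open>f = 1 - e\<close>, with \<open>j\<close> in all maximal ideals and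
  \<open>N\<close> so large that \<open>j t\<^sup>N\<close> has its inverse in every member of \<open>X\<close> that does not contain \<open>t\<close>.
  One power of \<open>t\<close> more than this makes the inverse a nonunit, which is needed for \<open>e\<close> to be one.\<close>

lemma rank_one_partition:
  assumes X: "X \<in> qc_rank_one_sets R" and t: "t \<in> carrier R" "t \<noteq> \<zero>"
  obtains e f where "e \<in> carrier R" "f \<in> carrier R" "e \<oplus> f = \<one>"
    "\<And>V. V \<in> X \<Longrightarrow> e \<in> V \<and> f \<in> V \<and> e \<otimes> t \<in> V \<and> f \<otimes> inv t \<in> V"
    "\<And>V. V \<in> X \<Longrightarrow> t \<in> V \<Longrightarrow> f \<in> val_max_ideal R V"
    "\<And>V. V \<in> X \<Longrightarrow> t \<notin> V \<Longrightarrow> e \<in> val_max_ideal R V"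
proof -
  note XD = qc_rank_oneD[OF X]
  obtain j where j: "j \<in> carrier R" "j \<noteq> \<zero>" and jM: "\<And>V. V \<in> X \<Longrightarrow> j \<in> val_max_ideal R V"
    using XD(5) by blast
  define u where "u = inv t"
  define i where "i = inv j"
  note tp = inv_props[OF t, folded u_def] and jp = inv_props[OF j, folded i_def]
  have tu: "inv t = u" by (simp add: u_def)
  have uM: "u \<in> val_max_ideal R V" "u \<in> V" if "V \<in> X" "t \<notin> V" for V
    using inv_in_val_max_ideal[OF XD(3) t(1)] val_max_idealD(1)[OF XD(3) XD(3)] that
    unfolding u_def by blast+
  have "t \<in> V \<or> (\<exists>n::nat. u [^] n \<otimes> i \<in> V)" if V: "V \<in> X" for V
  proof (cases "t \<in> V")
    case False
    obtain n :: nat where "u [^] n \<otimes> i \<in> V"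
      by (rule rank_one_archimedean[OF XD(2)[OF V] uM(1)[OF V False] jp(1)])
    then show ?thesis by blast
  qed simp
  then obtain N :: nat where N: "\<And>V. V \<in> X \<Longrightarrow> t \<in> V \<or> (\<exists>n\<le>N. u [^] n \<otimes> i \<in> V)"
    using zariski_uniform_bound[OF XD(4) t(1), of "\<lambda>n. u [^] n \<otimes> i"] tp jp by auto
  define w where "w = u [^] N \<otimes> i"
  define p where "p = t [^] N \<otimes> j"
  define y where "y = p \<otimes> t"
  have c: "w \<in> carrier R" "p \<in> carrier R" "y \<in> carrier R"
    using tp jp j t by (auto simp: w_def p_def y_def)
  have wp: "w \<otimes> p = \<one>"
  proof -
    have "w \<otimes> p = (t [^] N \<otimes> u [^] N) \<otimes> (j \<otimes> i)"
      using tp(1) jp(1) j t by (simp add: w_def p_def m_ac)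
    also have "t [^] N \<otimes> u [^] N = \<one>"
      using nat_pow_distrib[of t u N] tp t by simp
    finally show ?thesis using jp by simp
  qed
  have wV: "w \<in> V" if V: "V \<in> X" "t \<notin> V" for V
  proof -
    note VE = subringE[OF Zar_subring[OF XD(3)[OF V(1)]]]
    obtain n where n: "n \<le> N" "u [^] n \<otimes> i \<in> V" using N V by blast
    have "u [^] m \<in> V" for m :: nat
      by (induction m) (use VE uM(2)[OF V] in auto)
    then have "u [^] (N - n) \<otimes> (u [^] n \<otimes> i) \<in> V" using n VE(6) by blast
    also have "u [^] (N - n) \<otimes> (u [^] n \<otimes> i) = w"
      using n tp jp by (simp add: w_def nat_pow_mult flip: m_assoc)
    finally show ?thesis .
  qed
  have yM: "y \<in> val_max_ideal R V" "p \<in> V" if V: "V \<in> X" "t \<in> V" for V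
  proof -
    note M = val_max_idealD[OF XD(3) XD(3), OF V(1) V(1)]
    note VE = subringE[OF Zar_subring[OF XD(3)[OF V(1)]]]
    have "t [^] m \<in> V" for m :: nat
      by (induction m) (use VE V in auto)
    then have pM: "p \<in> val_max_ideal R V" using M(5) jM[OF V(1)] by (simp add: p_def)
    then show "p \<in> V" using M(1) by blast
    have "y = t \<otimes> p" using c t by (simp add: y_def m_comm)
    then show "y \<in> val_max_ideal R V" using M(5)[OF V(2) pM] by simp
  qed
  define z where "z = w \<otimes> u"
  have zc: "z \<in> carrier R" using c tp by (simp add: z_def)
  have zy: "z \<otimes> y = \<one>"
  proof -
    have "z \<otimes> y = (w \<otimes> p) \<otimes> (t \<otimes> u)"
      using c tp(1) t by (simp add: z_def y_def m_ac)
    then show ?thesis using wp tp by simp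
  qed
  have zM: "z \<in> val_max_ideal R V" if V: "V \<in> X" "t \<notin> V" for V
    using val_max_idealD(5)[OF XD(3) XD(3) wV uM(1)] V unfolding z_def by blast
  have unit: "inv (\<one> \<oplus> m) \<in> V" "\<one> \<oplus> m \<noteq> \<zero>"
    if "V \<in> X" "m \<in> val_max_ideal R V" for V m
    using val_unit_add[OF XD(3) _ _ that(2), of \<one>] val_unit[OF XD(3)]
      subringE(3)[OF Zar_subring[OF XD(3)]] val_max_idealD(3)[OF XD(3) XD(3)] that(1)
    by blast+
  have y1: "z \<otimes> (\<one> \<oplus> y) = \<one> \<oplus> z"
    using zc c zy by (simp add: r_distr a_comm)
  \<comment> \<open>The sum is a unit in a member that contains \<open>t\<close>, and \<open>1 + y\<^sup>-\<^sup>1\<close> is one in any other member.\<close>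
  have y0: "\<one> \<oplus> y \<noteq> \<zero>"
  proof -
    obtain V where V: "V \<in> X" using XD(1) by blast
    show ?thesis
    proof (cases "t \<in> V")
      case True
      then show ?thesis using unit(2)[OF V yM(1)[OF V]] by blast
    next
      case False
      then have "\<one> \<oplus> z \<noteq> \<zero>" using unit(2)[OF V zM[OF V]] by blast
      then show ?thesis using y1 zc by auto
    qed
  qed
  define e where "e = inv (\<one> \<oplus> y)"
  define f where "f = e \<otimes> y"
  have e: "e \<in> carrier R" "e \<otimes> (\<one> \<oplus> y) = \<one>"
    using inv_props[OF _ y0] c by (auto simp: e_def)
  have f: "f \<in> carrier R" "e \<oplus> f = \<one>"
    using e c by (auto simp: f_def r_distr)
  \<comment> \<open>If \<open>t\<close> has a pole, \<open>f = 1 / (1 + z)\<close> with \<open>z = y\<^sup>-\<^sup>1\<close> in the maximal ideal.\<close>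
  have pole: "e = z \<otimes> f \<and> f \<in> V" if V: "V \<in> X" "t \<notin> V" for V
  proof -
    define g where "g = inv (\<one> \<oplus> z)"
    have g: "g \<in> V" "g \<in> carrier R" "(\<one> \<oplus> z) \<otimes> g = \<one>"
      using unit[OF V(1) zM[OF V]] inv_props[of "\<one> \<oplus> z"] zc by (auto simp: g_def)
    have "(\<one> \<oplus> y) \<otimes> (z \<otimes> g) = z \<otimes> (\<one> \<oplus> y) \<otimes> g"
      using c zc g by (simp add: m_ac)
    then have "(\<one> \<oplus> y) \<otimes> (z \<otimes> g) = \<one>" using y1 g by simp
    then have ez: "e = z \<otimes> g"
      using comm_inv_char[of "\<one> \<oplus> y" "z \<otimes> g"] c zc g by (simp add: e_def)
    have "f = (z \<otimes> y) \<otimes> g" using c zc g by (simp add: f_def ez m_ac)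
    then have "f = g" using zy g by simp
    then show ?thesis using ez g by simp
  qed
  have fu: "f \<otimes> u = e \<otimes> p"
  proof -
    have "f \<otimes> u = (e \<otimes> p) \<otimes> (t \<otimes> u)"
      using e c t tp by (simp add: f_def y_def m_ac)
    then show ?thesis using tp e c by simp
  qed
  show ?thesis
  proof (rule that[OF e(1) f])
    fix V assume V: "V \<in> X"
    note VE = subringE[OF Zar_subring[OF XD(3)[OF V]]]
    note M = val_max_idealD[OF XD(3) XD(3), OF V V]
    show fM: "f \<in> val_max_ideal R V" if "t \<in> V"
      using M(5)[OF unit(1) yM(1)] yM(1) V that unfolding f_def e_def by blast
    show eM: "e \<in> val_max_ideal R V" if "t \<notin> V"
    proof -
      have "e = f \<otimes> z" using pole[OF V that] f zc by (simp add: m_comm)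
      then show ?thesis using M(5)[OF _ zM[OF V that]] pole[OF V that] by simp
    qed
    show "e \<in> V \<and> f \<in> V \<and> e \<otimes> t \<in> V \<and> f \<otimes> inv t \<in> V"
    proof (cases "t \<in> V")
      case True
      then have "e \<in> V" using unit(1)[OF V yM(1)[OF V]] by (simp add: e_def)
      then show ?thesis
        unfolding tu fu using fM[OF True] M(1) VE(6) True yM(2)[OF V True] by blast
    next
      case False
      have "e \<otimes> t = (w \<otimes> f) \<otimes> (t \<otimes> u)"
        using pole[OF V False] c f(1) t tp(1) by (simp add: z_def m_ac)
      then have "e \<otimes> t = w \<otimes> f" using tp c f by simp
      then show ?thesis
        unfolding tu using eM[OF False] pole[OF V False] M(1) VE(6) wV[OF V False] uM(2)[OF V False]
        by auto
    qed
  qed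
qed


lemma val_Inter_subring:
  assumes "X \<noteq> {}" "X \<subseteq> Zar R"
  shows "subring (val_Inter X) R"
proof -
  have "subring (\<Inter>X) R"
    using assms Zar_subring by (intro subring_Inter) auto
  then show ?thesis by (simp add: val_Inter_def)
qed

lemma qc_val_Inter_subring:
  assumes "X \<in> qc_rank_one_sets R"
  shows "subring (val_Inter X) R"
  using val_Inter_subring qc_rank_oneD(1,3)[OF assms] by blast

text \<open>A replacement for gcds: with \<open>e\<close> and \<open>f\<close> the partition for \<open>t = a\<^sup>-\<^sup>1\<close>, take
  \<open>c = e a + f b\<close> if \<open>a \<noteq> 0\<close>. Where \<open>a\<close> is a unit, \<open>c\<close> is congruent to \<open>a\<close>; elsewhere it is congruent
  to \<open>b\<close>.\<close>

lemma qc_unit_combination: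
  assumes X: "X \<in> qc_rank_one_sets R" and I: "ideal I (R\<lparr>carrier := val_Inter X\<rparr>)"
    and ab: "a \<in> I" "b \<in> I"
  obtains c where "c \<in> I" "\<And>V. V \<in> X \<Longrightarrow>
    a \<notin> val_max_ideal R V \<or> b \<notin> val_max_ideal R V \<Longrightarrow> c \<notin> val_max_ideal R V"
proof -
  note XD = qc_rank_oneD[OF X]
  note A = qc_val_Inter_subring[OF X]
  note AE = subringE[OF A]
  have ID: "I \<subseteq> val_Inter X" "\<And>x y. x \<in> I \<Longrightarrow> y \<in> I \<Longrightarrow> x \<oplus> y \<in> I"
    "\<And>s x. s \<in> val_Inter X \<Longrightarrow> x \<in> I \<Longrightarrow> s \<otimes> x \<in> I"
    using I unfolding ideal_subring_iff[OF A] by auto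
  have abV: "a \<in> V" "b \<in> V" if "V \<in> X" for V
    using ID(1) ab that unfolding val_Inter_def by blast+
  have abc: "a \<in> carrier R" "b \<in> carrier R" using ID(1) ab AE(1) by auto
  show ?thesis
  proof (cases "a = \<zero>")
    case True
    then have "a \<in> val_max_ideal R V" if "V \<in> X" for V
      using val_max_idealD(2)[OF XD(3) XD(3), OF that that] by simp
    then show ?thesis using that ab by blast
  next
    case False
    note ia = inv_props[OF abc(1) False]
    obtain e f where ef: "e \<in> carrier R" "f \<in> carrier R" "e \<oplus> f = \<one>"
      "\<And>V. V \<in> X \<Longrightarrow> e \<in> V \<and> f \<in> V \<and> e \<otimes> inv a \<in> V \<and> f \<otimes> inv (inv a) \<in> V"
      "\<And>V. V \<in> X \<Longrightarrow> inv a \<in> V \<Longrightarrow> f \<in> val_max_ideal R V"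
      "\<And>V. V \<in> X \<Longrightarrow> inv a \<notin> V \<Longrightarrow> e \<in> val_max_ideal R V"
      by (rule rank_one_partition[OF X ia(1,2)]) blast+
    have "e \<in> val_Inter X" "f \<in> val_Inter X" using ef(4) by (auto simp: val_Inter_def)
    then have cI: "e \<otimes> a \<oplus> f \<otimes> b \<in> I" using ID(2,3) ab by simp
    show ?thesis
    proof (rule that[OF cI])
      fix V assume V: "V \<in> X"
        and nab: "a \<notin> val_max_ideal R V \<or> b \<notin> val_max_ideal R V"
      note Z = XD(3)[OF V]
      note M = val_max_idealD[OF Z Z] and VE = subringE[OF Zar_subring[OF Z]]
      have efV: "e \<in> V" "f \<in> V" using ef(4)[OF V] by auto
      have nef: "e \<notin> val_max_ideal R V \<or> f \<notin> val_max_ideal R V"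
        using M(3) M(4)[of e f] ef(3) by auto
      have comm: "a \<otimes> e = e \<otimes> a" "b \<otimes> f = f \<otimes> b" "f \<otimes> b \<oplus> e \<otimes> a = e \<otimes> a \<oplus> f \<otimes> b"
        using abc ef by (auto simp: m_comm a_comm)
      show "e \<otimes> a \<oplus> f \<otimes> b \<notin> val_max_ideal R V"
      proof (cases "inv a \<in> V")
        case True
        then have fM: "f \<in> val_max_ideal R V" using ef(5)[OF V] by simp
        have "a \<notin> val_max_ideal R V" using True False by (simp add: val_max_ideal_eq[OF Z])
        then have "e \<otimes> a \<notin> val_max_ideal R V"
          using M(6)[OF efV(1) abV(1)[OF V]] nef fM by blast
        moreover have "f \<otimes> b \<in> val_max_ideal R V"
          using M(5)[OF abV(2)[OF V] fM] comm by simp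
        ultimately show ?thesis
          using val_unit_add(2)[OF Z] VE(6)[OF efV(1) abV(1)[OF V]] by blast
      next
        case F: False
        then have eM: "e \<in> val_max_ideal R V" using ef(6)[OF V] by simp
        have "a \<in> val_max_ideal R V" using F abV(1)[OF V] by (simp add: val_max_ideal_eq[OF Z])
        then have "f \<otimes> b \<notin> val_max_ideal R V"
          using M(6)[OF efV(2) abV(2)[OF V]] nef nab eM by blast
        moreover have "e \<otimes> a \<in> val_max_ideal R V"
          using M(5)[OF abV(1)[OF V] eM] comm by simp
        ultimately have "f \<otimes> b \<oplus> e \<otimes> a \<notin> val_max_ideal R V"
          using val_unit_add(2)[OF Z] VE(6)[OF efV(2) abV(2)[OF V]] by blast
        then show ?thesis using comm by simp
      qed
    qed
  qed
qed

text \<open>If \<open>M\<close> lay in no center, finitely many elements of \<open>M\<close> would suffice to have a unit among them in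
  each member of \<open>X\<close>; combining them gives a single element of \<open>M\<close> that is a unit in every
  member, hence in the intersection.\<close>

lemma qc_maximal_has_center:
  assumes X: "X \<in> qc_rank_one_sets R"
    and M: "maximalideal M (R\<lparr>carrier := val_Inter X\<rparr>)"
  obtains V where "V \<in> X" "M = val_max_ideal R V \<inter> val_Inter X"
proof -
  let ?A = "val_Inter X"
  note XD = qc_rank_oneD[OF X]
  note A = qc_val_Inter_subring[OF X]
  note AE = subringE[OF A]
  note MD = primeideal_subringD[OF A maximal_imp_primeideal_subring[OF A M]]
  have Mid: "ideal M (R\<lparr>carrier := ?A\<rparr>)" using M by (rule maximalideal.axioms(1))
  have AV: "x \<in> V" if "x \<in> ?A" "V \<in> X" for x V using that by (auto simp: val_Inter_def)
  have "\<exists>V\<in>X. M \<subseteq> val_max_ideal R V"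
  proof (rule ccontr)
    assume none: "\<not> (\<exists>V\<in>X. M \<subseteq> val_max_ideal R V)"
    have cover: "\<exists>x\<in>m_inv R ` (M - {\<zero>}). x \<in> V" if V: "V \<in> X" for V
    proof -
      obtain m where m: "m \<in> M" "m \<notin> val_max_ideal R V" using none V by blast
      then have "m \<noteq> \<zero>" "inv m \<in> V" using val_unit[OF XD(3)[OF V] AV[OF _ V]] MD(1) by auto
      then show ?thesis using m by blast
    qed
    have sub: "m_inv R ` (M - {\<zero>}) \<subseteq> carrier R"
      using inv_props(1) MD(1) AE(1) by auto
    obtain T where T: "finite T" "T \<subseteq> m_inv R ` (M - {\<zero>})"
      "\<And>V. V \<in> X \<Longrightarrow> \<exists>x\<in>T. x \<in> V"
      by (rule zariski_finite_cover[OF XD(4) sub cover]) blast+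
    obtain S where S: "finite S" "S \<subseteq> M - {\<zero>}" "T = m_inv R ` S"
      using finite_subset_image[OF T(1,2)] by blast
    have "\<exists>c\<in>M. \<forall>V\<in>X. (\<exists>m\<in>S. m \<notin> val_max_ideal R V) \<longrightarrow> c \<notin> val_max_ideal R V"
      using S(1,2)
    proof (induction S rule: finite_induct)
      case empty
      then show ?case using MD(2) by blast
    next
      case (insert m S)
      then obtain c where c: "c \<in> M"
        "\<And>V. V \<in> X \<Longrightarrow> \<exists>m\<in>S. m \<notin> val_max_ideal R V \<Longrightarrow> c \<notin> val_max_ideal R V" by blast
      have "m \<in> M" using insert by blast
      then obtain d where d: "d \<in> M" "\<And>V. V \<in> X \<Longrightarrow>
          m \<notin> val_max_ideal R V \<or> c \<notin> val_max_ideal R V \<Longrightarrow> d \<notin> val_max_ideal R V"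
        using qc_unit_combination[OF X Mid _ c(1)] by blast
      show ?case
      proof (intro bexI[OF _ d(1)] ballI impI)
        fix V assume V: "V \<in> X" "\<exists>m\<in>insert m S. m \<notin> val_max_ideal R V"
        then show "d \<notin> val_max_ideal R V" using c(2)[OF V(1)] d(2)[OF V(1)] by blast
      qed
    qed
    then obtain c where c: "c \<in> M"
      "\<And>V. V \<in> X \<Longrightarrow> \<exists>m\<in>S. m \<notin> val_max_ideal R V \<Longrightarrow> c \<notin> val_max_ideal R V"
      by blast
    have cV: "c \<noteq> \<zero> \<and> inv c \<in> V" if V: "V \<in> X" for V
    proof -
      obtain m where m: "m \<in> S" "inv m \<in> V" using T(3)[OF V] S(3) by blast
      then have "m \<notin> val_max_ideal R V" using S(2) by (auto simp: val_max_ideal_eq[OF XD(3)[OF V]])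
      then have "c \<notin> val_max_ideal R V" using c(2)[OF V] m by blast
      then show ?thesis using val_unit[OF XD(3)[OF V] AV[OF _ V]] c(1) MD(1) by auto
    qed
    then have "inv c \<in> ?A" "c \<noteq> \<zero>" using XD(1) by (auto simp: val_Inter_def)
    moreover have "c \<in> carrier R" using c(1) MD(1) AE(1) by auto
    ultimately have "\<one> \<in> M" using MD(5)[OF _ c(1), of "inv c"] inv_props(4)[of c] by simp
    then show False using MD(3) by simp
  qed
  then obtain V where V: "V \<in> X" "M \<subseteq> val_max_ideal R V" by blast
  note Z = XD(3)[OF V(1)]
  have "?A \<subseteq> V" using AV[OF _ V(1)] by blast
  note P = primeideal_contract[OF A Zar_subring[OF Z] this val_max_ideal_prime[OF Z]]
  have "val_max_ideal R V \<inter> ?A = M \<or> val_max_ideal R V \<inter> ?A = carrier (R\<lparr>carrier := ?A\<rparr>)"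
    using V(2) MD(1) by (intro maximalideal.I_maximal[OF M] primeideal.axioms(1)[OF P]) auto
  then have "M = val_max_ideal R V \<inter> ?A"
    using primeideal_subringD(3)[OF A P] AE(3) by auto
  then show ?thesis using that V by blast
qed

lemma center_prime:
  assumes X: "X \<in> qc_rank_one_sets R" and V: "V \<in> X"
  shows "primeideal (val_max_ideal R V \<inter> val_Inter X) (R\<lparr>carrier := val_Inter X\<rparr>)"
proof (rule primeideal_contract[OF qc_val_Inter_subring[OF X]])
  show "subring V R" "primeideal (val_max_ideal R V) (R\<lparr>carrier := V\<rparr>)"
    using Zar_subring val_max_ideal_prime qc_rank_oneD(3)[OF X V] by auto
  show "val_Inter X \<subseteq> V" using V by (auto simp: val_Inter_def)
qed

text \<open>For \<open>x \<in> V\<close>, the first half \<open>e\<close> of the partition for \<open>x\<close> is a denominator of \<open>x\<close> and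
  a unit in \<open>V\<close>.\<close>

lemma localization_center:
  assumes X: "X \<in> qc_rank_one_sets R" and V: "V \<in> X"
  shows "localization_in R (val_Inter X) (val_max_ideal R V \<inter> val_Inter X) = V"
proof -
  let ?A = "val_Inter X"
  note XD = qc_rank_oneD[OF X]
  note A = qc_val_Inter_subring[OF X] and Z = XD(3)[OF V]
  note AE = subringE[OF A] and VE = subringE[OF Zar_subring[OF Z]] and M = val_max_idealD[OF Z Z]
  note loc = localization_iff[OF A center_prime[OF X V]]
  have AV: "?A \<subseteq> V" using V by (auto simp: val_Inter_def)
  show ?thesis
  proof
    show "localization_in R ?A (val_max_ideal R V \<inter> ?A) \<subseteq> V"
    proof
      fix x assume "x \<in> localization_in R ?A (val_max_ideal R V \<inter> ?A)"
      then obtain s where s: "x \<in> carrier R" "s \<in> ?A" "s \<notin> val_max_ideal R V" "s \<otimes> x \<in> ?A"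
        unfolding loc by blast
      have sV: "s \<in> V" using s AV by blast
      note u = val_unit[OF Z sV s(3)]
      have sc: "s \<in> carrier R" using sV VE(1) by blast
      have "inv s \<otimes> (s \<otimes> x) \<in> V" using VE(6)[OF u(2)] s(4) AV by blast
      then show "x \<in> V" using inv_props[OF sc u(1)] sc s(1) by (simp flip: m_assoc)
    qed
    show "V \<subseteq> localization_in R ?A (val_max_ideal R V \<inter> ?A)"
    proof
      fix x assume x: "x \<in> V"
      then have xc: "x \<in> carrier R" using VE(1) by blast
      show "x \<in> localization_in R ?A (val_max_ideal R V \<inter> ?A)"
      proof (cases "x = \<zero>")
        case True
        then show ?thesis using subset_localization[OF A center_prime[OF X V]] AE(2) by blast
      next
        case False
        obtain e f where ef: "e \<in> carrier R" "f \<in> carrier R" "e \<oplus> f = \<one>"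
          "\<And>W. W \<in> X \<Longrightarrow> e \<in> W \<and> f \<in> W \<and> e \<otimes> x \<in> W \<and> f \<otimes> inv x \<in> W"
          "\<And>W. W \<in> X \<Longrightarrow> x \<in> W \<Longrightarrow> f \<in> val_max_ideal R W"
          "\<And>W. W \<in> X \<Longrightarrow> x \<notin> W \<Longrightarrow> e \<in> val_max_ideal R W"
          by (rule rank_one_partition[OF X xc False]) blast+
        have "e \<in> ?A" "e \<otimes> x \<in> ?A" using ef(4) by (auto simp: val_Inter_def)
        moreover have "e \<notin> val_max_ideal R V"
          using M(3) M(4)[of e f] ef(3) ef(5)[OF V x] by auto
        ultimately show ?thesis unfolding loc using xc by blast
      qed
    qed
  qed
qed

text \<open>A ring strictly larger than \<open>W\<close> contains some \<open>x\<close> with \<open>x\<^sup>-\<^sup>1\<close> in the maximal ideal of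
  \<open>W\<close>, and then, by the archimedean property, the whole field; but \<open>j\<close> has no inverse in \<open>V\<close>.\<close>

lemma rank_one_subset_eq:
  assumes W: "W \<in> rank_one_valuation_rings R" and V: "V \<in> Zar R" and WV: "W \<subseteq> V"
    and j: "j \<in> val_max_ideal R V" "j \<noteq> \<zero>"
  shows "W = V"
proof (rule ccontr)
  assume "W \<noteq> V"
  then obtain x where x: "x \<in> V" "x \<notin> W" using WV by blast
  have WZ: "W \<in> Zar R" using W by (simp add: rank_one_valuation_rings_def)
  note VE = subringE[OF Zar_subring[OF V]] and M = val_max_idealD[OF V V]
  have xc: "x \<in> carrier R" using x VE(1) by blast
  have jc: "j \<in> carrier R" using j(1) M(1) VE(1) by blast
  note ix = inv_in_val_max_ideal[OF WZ xc x(2)]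
  note xp = inv_props[OF xc ix(1)] and jp = inv_props[OF jc j(2)]
  obtain n :: nat where n: "inv x [^] n \<otimes> inv j \<in> W"
    by (rule rank_one_archimedean[OF W ix(2) jp(1)])
  have "x [^] m \<in> V" for m :: nat by (induction m) (use VE x in auto)
  then have "x [^] n \<otimes> (inv x [^] n \<otimes> inv j) \<in> V" using n WV VE(6) by blast
  also have "x [^] n \<otimes> (inv x [^] n \<otimes> inv j) = (x \<otimes> inv x) [^] n \<otimes> inv j"
    using nat_pow_distrib[of x "inv x" n] xc xp(1) jp(1) by (simp add: m_assoc)
  also have "\<dots> = inv j" using xp jp by simp
  finally show False using j by (simp add: val_max_ideal_eq[OF V])
qed

text \<open>A maximal ideal above the center of \<open>V\<close> is the center of some \<open>W\<close>, and the inclusion of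
  centers reverses to \<open>W \<subseteq> V\<close> on localizations.\<close>

lemma center_maximal:
  assumes X: "X \<in> qc_rank_one_sets R" and V: "V \<in> X"
  shows "maximalideal (val_max_ideal R V \<inter> val_Inter X) (R\<lparr>carrier := val_Inter X\<rparr>)"
proof -
  let ?A = "val_Inter X"
  note XD = qc_rank_oneD[OF X]
  note A = qc_val_Inter_subring[OF X]
  note P = center_prime[OF X V]
  obtain M where M: "maximalideal M (R\<lparr>carrier := ?A\<rparr>)" "val_max_ideal R V \<inter> ?A \<subseteq> M"
    by (rule subring_max_ideal_above[OF A primeideal.axioms(1)[OF P] primeideal_subringD(3)[OF A P]])
  obtain W where W: "W \<in> X" "M = val_max_ideal R W \<inter> ?A"
    by (rule qc_maximal_has_center[OF X M(1)])
  have "W \<subseteq> V"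
  proof
    fix x assume "x \<in> W"
    then have "x \<in> localization_in R ?A M" using localization_center[OF X W(1)] W(2) by simp
    then have "x \<in> localization_in R ?A (val_max_ideal R V \<inter> ?A)"
      using M(2) unfolding localization_in_def by blast
    then show "x \<in> V" using localization_center[OF X V] by simp
  qed
  then have "W = V"
    using rank_one_subset_eq[OF XD(2)[OF W(1)] XD(3)[OF V]] XD(5) V by blast
  then show ?thesis using M(1) W(2) by simp
qed

lemma Max_ideals_val_Inter:
  assumes X: "X \<in> qc_rank_one_sets R"
  shows "Max_ideals (R\<lparr>carrier := val_Inter X\<rparr>) = (\<lambda>V. val_max_ideal R V \<inter> val_Inter X) ` X"
proof
  show "Max_ideals (R\<lparr>carrier := val_Inter X\<rparr>) \<subseteq> (\<lambda>V. val_max_ideal R V \<inter> val_Inter X) ` X"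
    unfolding Max_ideals_def using qc_maximal_has_center[OF X] by blast
qed (use center_maximal[OF X] in \<open>auto simp: Max_ideals_def\<close>)

lemma max_localizations_val_Inter:
  assumes X: "X \<in> qc_rank_one_sets R"
  shows "max_localizations R (val_Inter X) = X"
  using localization_center[OF X]
  by (simp add: max_localizations_def Max_ideals_val_Inter[OF X] image_image)

text \<open>A nonzero prime \<open>Q\<close> inside the center \<open>N\<close> of \<open>W\<close> equals \<open>N\<close>: if \<open>0 \<noteq> p \<in> Q\<close> and
  \<open>m \<in> N\<close>, some power of \<open>m\<close> is divisible by \<open>p\<close> in \<open>W\<close>, hence in \<open>A\<close> up to a factor
  outside \<open>N\<close>.\<close>

lemma val_Inter_krull_dim:
  assumes X: "X \<in> qc_rank_one_sets R"
  shows "krull_dim (R\<lparr>carrier := val_Inter X\<rparr>) = 1"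
proof -
  let ?A = "val_Inter X"
  note XD = qc_rank_oneD[OF X]
  note A = qc_val_Inter_subring[OF X]
  note AE = subringE[OF A]
  obtain j where j: "j \<in> carrier R" "j \<noteq> \<zero>" and jM: "\<And>V. V \<in> X \<Longrightarrow> j \<in> val_max_ideal R V"
    using XD(5) by blast
  have jA: "j \<in> ?A" using jM val_max_idealD(1)[OF XD(3) XD(3)] by (auto simp: val_Inter_def)
  obtain V where V: "V \<in> X" using XD(1) by blast
  have chain: "{\<zero>} \<subset> val_max_ideal R V \<inter> ?A"
    using jA jM[OF V] j(2) val_max_idealD(2)[OF XD(3) XD(3), OF V V] AE(2) by blast
  have "False"
    if P: "primeideal P (R\<lparr>carrier := ?A\<rparr>)" and Q: "primeideal Q (R\<lparr>carrier := ?A\<rparr>)"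
      and S: "primeideal S (R\<lparr>carrier := ?A\<rparr>)" and PQ: "P \<subset> Q" and QS: "Q \<subset> S" for P Q S
  proof -
    note PD = primeideal_subringD[OF A P] and QD = primeideal_subringD[OF A Q]
      and SD = primeideal_subringD[OF A S]
    obtain p where p: "p \<in> Q" "p \<noteq> \<zero>" using PQ PD(2) by blast
    have pc: "p \<in> carrier R" using p QD(1) AE(1) by blast
    note ip = inv_props[OF pc p(2)]
    obtain N where N: "maximalideal N (R\<lparr>carrier := ?A\<rparr>)" "S \<subseteq> N"
      by (rule subring_max_ideal_above[OF A primeideal.axioms(1)[OF S] SD(3)])
    obtain W where W: "W \<in> X" "N = val_max_ideal R W \<inter> ?A"
      by (rule qc_maximal_has_center[OF X N(1)])
    note loc = localization_iff[OF A center_prime[OF X W(1)], unfolded localization_center[OF X W(1)]]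
    have "N \<subseteq> Q"
    proof
      fix m assume m: "m \<in> N"
      then have mA: "m \<in> ?A" "m \<in> val_max_ideal R W" "m \<in> carrier R" using W(2) AE(1) by auto
      obtain n :: nat where "m [^] n \<otimes> inv p \<in> W"
        by (rule rank_one_archimedean[OF XD(2)[OF W(1)] mA(2) ip(1)])
      then obtain s where s: "s \<in> ?A" "s \<notin> N" "s \<otimes> (m [^] n \<otimes> inv p) \<in> ?A"
        unfolding loc W(2) by blast
      have sc: "s \<in> carrier R" using s AE(1) by blast
      have pw: "m [^] k \<in> ?A" for k :: nat by (induction k) (use AE mA in auto)
      have "s \<otimes> (m [^] n \<otimes> inv p) \<otimes> p \<in> Q" using QD(5)[OF s(3) p(1)] .
      also have "s \<otimes> (m [^] n \<otimes> inv p) \<otimes> p = s \<otimes> m [^] n"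
        using sc mA pc ip by (simp add: m_assoc)
      finally have "m [^] n \<in> Q" using QD(6)[OF s(1) pw] s(2) QS N(2) by blast
      moreover have "m [^] k \<in> Q \<Longrightarrow> m \<in> Q" for k :: nat
      proof (induction k)
        case 0
        then show ?case using QD(3) by simp
      next
        case (Suc k)
        then show ?case using QD(6)[OF pw[of k] mA(1)] by auto
      qed
      ultimately show "m \<in> Q" by blast
    qed
    then show False using QS N(2) by blast
  qed
  then show ?thesis
    unfolding krull_dim_eq_one_iff
    using chain primeideal_zero_subring[OF A] center_prime[OF X V] by blast
qed

text \<open>Some power of \<open>j\<close> is a denominator of \<open>x\<close> in all members of \<open>X\<close> at once.\<close>

lemma val_Inter_quotient_field:
  assumes X: "X \<in> qc_rank_one_sets R"
  shows "quotient_field_in R (val_Inter X) = carrier R"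
proof
  let ?A = "val_Inter X"
  note XD = qc_rank_oneD[OF X]
  note A = qc_val_Inter_subring[OF X]
  note AE = subringE[OF A]
  show "quotient_field_in R ?A \<subseteq> carrier R"
    using AE(1) inv_props(1) unfolding quotient_field_in_def by blast
  show "carrier R \<subseteq> quotient_field_in R ?A"
  proof
    fix x assume x: "x \<in> carrier R"
    obtain j where j: "j \<in> carrier R" "j \<noteq> \<zero>" and jM: "\<And>V. V \<in> X \<Longrightarrow> j \<in> val_max_ideal R V"
      using XD(5) by blast
    have "x \<in> V \<or> (\<exists>n::nat. j [^] n \<otimes> x \<in> V)" if V: "V \<in> X" for V
    proof -
      obtain n :: nat where "j [^] n \<otimes> x \<in> V"
        by (rule rank_one_archimedean[OF XD(2)[OF V] jM[OF V] x])
      then show ?thesis by blast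
    qed
    then obtain N :: nat where N: "\<And>V. V \<in> X \<Longrightarrow> x \<in> V \<or> (\<exists>n\<le>N. j [^] n \<otimes> x \<in> V)"
      using zariski_uniform_bound[OF XD(4) x, of "\<lambda>n. j [^] n \<otimes> x"] x j by auto
    have jn: "j [^] N \<otimes> x \<in> V \<and> j [^] N \<in> V" if V: "V \<in> X" for V
    proof -
      note VE = subringE[OF Zar_subring[OF XD(3)[OF V]]]
      have "j \<in> V" using jM[OF V] val_max_idealD(1)[OF XD(3) XD(3), OF V V] by blast
      then have pw: "j [^] k \<in> V" for k :: nat by (induction k) (use VE in auto)
      have "\<exists>n\<le>N. j [^] n \<otimes> x \<in> V" using N[OF V] x by (auto intro: exI[of _ 0])
      then obtain n where n: "n \<le> N" "j [^] n \<otimes> x \<in> V" by blast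
      have "j [^] (N - n) \<otimes> (j [^] n \<otimes> x) \<in> V" using VE(6)[OF pw n(2)] .
      also have "j [^] (N - n) \<otimes> (j [^] n \<otimes> x) = j [^] N \<otimes> x"
        using n j x by (simp add: nat_pow_mult flip: m_assoc)
      finally show ?thesis using pw by blast
    qed
    have s: "j [^] N \<in> carrier R" "j [^] N \<noteq> \<zero>" using j pow_nonzero by auto
    have "j [^] N \<otimes> x \<otimes> inv (j [^] N) = x \<otimes> (j [^] N \<otimes> inv (j [^] N))"
      using s inv_props[OF s] x by (simp only: m_ac m_closed)
    then have "x = j [^] N \<otimes> x \<otimes> inv (j [^] N)" using inv_props[OF s] x by simp
    moreover have "j [^] N \<otimes> x \<in> ?A" "j [^] N \<in> ?A - {\<zero>}"
      using jn s by (auto simp: val_Inter_def)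
    ultimately show "x \<in> quotient_field_in R ?A"
      unfolding quotient_field_in_def by blast
  qed
qed

lemma val_Inter_in_one_dim_pruefer_domains:
  assumes X: "X \<in> qc_rank_one_sets R"
  shows "val_Inter X \<in> one_dim_pruefer_domains R"
proof -
  let ?A = "val_Inter X"
  note XD = qc_rank_oneD[OF X]
  note A = qc_val_Inter_subring[OF X]
  have "valuation_domain_in R V" if V: "V \<in> X" for V
  proof -
    note VE = subringE[OF Zar_subring[OF XD(3)[OF V]]]
    have "quotient_field_in R V \<subseteq> carrier R"
      using VE(1) inv_props(1) unfolding quotient_field_in_def by blast
    then show ?thesis
      using subdomainI'[OF Zar_subring[OF XD(3)[OF V]]] Zar_cases[OF XD(3)[OF V]]
      unfolding valuation_domain_in_def by blast
  qed
  then have "pruefer_domain_in R ?A"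
    using subdomainI'[OF A] localization_center[OF X]
    by (auto simp: pruefer_domain_in_def Max_ideals_val_Inter[OF X])
  moreover have "jacobson_radical (R\<lparr>carrier := ?A\<rparr>) \<noteq> {\<zero>}"
  proof -
    obtain j where j: "j \<noteq> \<zero>" "\<And>V. V \<in> X \<Longrightarrow> j \<in> val_max_ideal R V"
      using XD(5) by blast
    have "j \<in> ?A" using j val_max_idealD(1)[OF XD(3) XD(3)] by (auto simp: val_Inter_def)
    then have "j \<in> jacobson_radical (R\<lparr>carrier := ?A\<rparr>)"
      using j(2) by (auto simp: jacobson_radical_def Max_ideals_val_Inter[OF X])
    then show ?thesis using j by blast
  qed
  ultimately show ?thesis
    using val_Inter_krull_dim[OF X] val_Inter_quotient_field[OF X]
    by (simp add: one_dim_pruefer_domains_def)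
qed


section \<open>One-dimensional Pruefer domains\<close>

lemma one_dim_pruefer_domainsD:
  assumes "A \<in> one_dim_pruefer_domains R"
  shows "subring A R" "krull_dim (R\<lparr>carrier := A\<rparr>) = 1" "quotient_field_in R A = carrier R"
    "maximalideal M (R\<lparr>carrier := A\<rparr>) \<Longrightarrow> valuation_domain_in R (localization_in R A M)"
    "jacobson_radical (R\<lparr>carrier := A\<rparr>) \<noteq> {\<zero>}"
  using assms
  by (auto simp: one_dim_pruefer_domains_def pruefer_domain_in_def Max_ideals_def
      subdomain_def subcring_def)

lemma pruefer_jacobson_element:
  assumes A: "A \<in> one_dim_pruefer_domains R"
  obtains j where "j \<noteq> \<zero>" "\<And>M. maximalideal M (R\<lparr>carrier := A\<rparr>) \<Longrightarrow> j \<in> M"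
proof -
  note AD = one_dim_pruefer_domainsD[OF A]
  have "\<zero> \<in> M" if "maximalideal M (R\<lparr>carrier := A\<rparr>)" for M
    using primeideal_subringD(2)[OF AD(1) maximal_imp_primeideal_subring[OF AD(1) that]] .
  then have "\<zero> \<in> jacobson_radical (R\<lparr>carrier := A\<rparr>)"
    by (auto simp: jacobson_radical_def Max_ideals_def)
  then obtain j where "j \<in> jacobson_radical (R\<lparr>carrier := A\<rparr>)" "j \<noteq> \<zero>"
    using AD(5) by blast
  then show ?thesis using that by (auto simp: jacobson_radical_def Max_ideals_def)
qed

lemma pruefer_localization_Zar:
  assumes A: "A \<in> one_dim_pruefer_domains R" and M: "maximalideal M (R\<lparr>carrier := A\<rparr>)"
  shows "localization_in R A M \<in> Zar R"
proof -
  let ?V = "localization_in R A M"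
  note AD = one_dim_pruefer_domainsD[OF A]
  note P = maximal_imp_primeideal_subring[OF AD(1) M]
  have "quotient_field_in R A \<subseteq> quotient_field_in R ?V"
    using subset_localization[OF AD(1) P] unfolding quotient_field_in_def by blast
  then show ?thesis
    using AD(3) AD(4)[OF M] localization_subring[OF AD(1) P]
    unfolding Zar_def valuation_domain_in_def by blast
qed

lemma localization_max_ideal_contract:
  assumes A: "subring A R" and M: "primeideal M (R\<lparr>carrier := A\<rparr>)"
    and Z: "localization_in R A M \<in> Zar R"
  shows "val_max_ideal R (localization_in R A M) \<inter> A = M"
proof -
  let ?V = "localization_in R A M"
  note AE = subringE[OF A] and MD = primeideal_subringD[OF A M]
  have AV: "A \<subseteq> ?V" by (rule subset_localization[OF A M])
  have "m \<in> val_max_ideal R ?V" if m: "m \<in> M" for m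
  proof (rule ccontr)
    assume n: "m \<notin> val_max_ideal R ?V"
    have mV: "m \<in> ?V" "m \<in> carrier R" using m MD(1) AV AE(1) by auto
    note u = val_unit[OF Z mV(1) n]
    then obtain s where s: "s \<in> A" "s \<notin> M" "s \<otimes> inv m \<in> A"
      unfolding localization_iff[OF A M] by blast
    have "s \<otimes> inv m \<otimes> m = s"
      using s(1) AE(1) mV inv_props[OF mV(2) u(1)] by (simp add: m_assoc subset_iff)
    then show False using MD(5)[OF s(3) m] s(2) by simp
  qed
  moreover have "a \<in> M" if a: "a \<in> A" "a \<in> val_max_ideal R ?V" for a
  proof (rule ccontr)
    assume n: "a \<notin> M"
    then have "inv a \<in> ?V" using localization_inv[OF A M] a by blast
    moreover have "a \<noteq> \<zero>" using n MD(2) by blast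
    ultimately show False using a by (simp add: val_max_ideal_eq[OF Z])
  qed
  ultimately show ?thesis using MD(1) by blast
qed

text \<open>The maximal ideal is nonzero because it contains the Jacobson radical of \<open>A\<close>, and a chain of
  three primes would contract to such a chain in \<open>A\<close>.\<close>

lemma pruefer_localization_rank_one:
  assumes A: "A \<in> one_dim_pruefer_domains R" and M: "maximalideal M (R\<lparr>carrier := A\<rparr>)"
  shows "localization_in R A M \<in> rank_one_valuation_rings R"
proof -
  let ?V = "localization_in R A M"
  note AD = one_dim_pruefer_domainsD[OF A]
  note P = maximal_imp_primeideal_subring[OF AD(1) M]
  note Z = pruefer_localization_Zar[OF A M]
  note sub = localization_subring[OF AD(1) P]
  obtain j where j: "j \<noteq> \<zero>" "j \<in> M"
    using pruefer_jacobson_element[OF A] M by blast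
  have "j \<in> val_max_ideal R ?V"
    using j localization_max_ideal_contract[OF AD(1) P Z] by blast
  then have "{\<zero>} \<subset> val_max_ideal R ?V"
    using j val_max_idealD(2)[OF Z Z] by blast
  moreover have False
    if "primeideal T (R\<lparr>carrier := ?V\<rparr>)" "primeideal Q (R\<lparr>carrier := ?V\<rparr>)"
      "primeideal S (R\<lparr>carrier := ?V\<rparr>)" "T \<subset> Q" "Q \<subset> S" for T Q S
  proof -
    note con = primeideal_contract[OF AD(1) sub subset_localization[OF AD(1) P]]
    note str = localization_prime_strict_contract[OF AD(1) P]
    show False
      using AD(2) con[OF that(1)] con[OF that(2)] con[OF that(3)]
        str[OF that(1,2,4)] str[OF that(2,3,5)]
      unfolding krull_dim_eq_one_iff by blast
  qed
  ultimately have "krull_dim (R\<lparr>carrier := ?V\<rparr>) = 1"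
    unfolding krull_dim_eq_one_iff
    using primeideal_zero_subring[OF sub] val_max_ideal_prime[OF Z] by blast
  then show ?thesis using Z by (simp add: rank_one_valuation_rings_def)
qed

text \<open>The denominators of an element of the intersection form an ideal of \<open>A\<close> that lies in no
  maximal ideal.\<close>

lemma Inter_max_localizations:
  assumes A: "subring A R" and ne: "Max_ideals (R\<lparr>carrier := A\<rparr>) \<noteq> {}"
  shows "val_Inter (max_localizations R A) = A"
proof
  note AE = subringE[OF A]
  have P: "primeideal M (R\<lparr>carrier := A\<rparr>)" if "maximalideal M (R\<lparr>carrier := A\<rparr>)" for M
    by (rule maximal_imp_primeideal_subring[OF A that])
  show "A \<subseteq> val_Inter (max_localizations R A)"
    using subset_localization[OF A P] by (auto simp: val_Inter_def max_localizations_def Max_ideals_def)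
  show "val_Inter (max_localizations R A) \<subseteq> A"
  proof
    fix x assume "x \<in> val_Inter (max_localizations R A)"
    then have x: "x \<in> localization_in R A M" if "maximalideal M (R\<lparr>carrier := A\<rparr>)" for M
      using that by (auto simp: val_Inter_def max_localizations_def Max_ideals_def)
    obtain M where "maximalideal M (R\<lparr>carrier := A\<rparr>)" using ne by (auto simp: Max_ideals_def)
    then have xc: "x \<in> carrier R" using x localization_iff[OF A P] by blast
    define I where "I = {s \<in> A. s \<otimes> x \<in> A}"
    have IA: "ideal I (R\<lparr>carrier := A\<rparr>)"
      unfolding ideal_subring_iff[OF A]
    proof (intro conjI ballI)
      show "I \<subseteq> A" "\<zero> \<in> I" using AE(2) xc by (auto simp: I_def)
      fix s assume s: "s \<in> I"
      then have sA: "s \<in> A" "s \<otimes> x \<in> A" "s \<in> carrier R" using AE(1) by (auto simp: I_def)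
      show "s \<oplus> r \<in> I" if "r \<in> I" for r
      proof -
        have rA: "r \<in> A" "r \<otimes> x \<in> A" "r \<in> carrier R" using that AE(1) by (auto simp: I_def)
        then show ?thesis using sA AE(7) xc by (simp add: I_def l_distr)
      qed
      show "a \<otimes> s \<in> I" if "a \<in> A" for a
      proof -
        have "a \<in> carrier R" using that AE(1) by blast
        then show ?thesis using sA that AE(6) xc by (simp add: I_def m_assoc)
      qed
    qed
    have "\<one> \<in> I"
    proof (rule ccontr)
      assume "\<one> \<notin> I"
      then obtain M where M: "maximalideal M (R\<lparr>carrier := A\<rparr>)" "I \<subseteq> M"
        by (rule subring_max_ideal_above[OF A IA])
      then show False
        using x[OF M(1)] localization_iff[OF A P[OF M(1)]] unfolding I_def by blast
    qed
    then show "x \<in> A" using xc by (simp add: I_def)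
  qed
qed

lemma localization_common_denominator:
  assumes A: "subring A R" and P: "primeideal P (R\<lparr>carrier := A\<rparr>)"
    and S: "finite S" "S \<subseteq> localization_in R A P"
  shows "\<exists>s\<in>A - P. \<forall>x\<in>S. s \<otimes> x \<in> A"
  using S
proof (induction S rule: finite_induct)
  case empty
  then show ?case using subringE(3)[OF A] primeideal_subringD(3)[OF A P] by blast
next
  case (insert y S)
  note AE = subringE[OF A]
  obtain s where s: "s \<in> A - P" "\<forall>x\<in>S. s \<otimes> x \<in> A" using insert by blast
  obtain r where r: "y \<in> carrier R" "r \<in> A - P" "r \<otimes> y \<in> A"
    using insert.prems localization_iff[OF A P, of y] by auto
  have c: "s \<in> carrier R" "r \<in> carrier R" using s r AE(1) by auto
  have "r \<otimes> s \<in> A - P" using s r AE(6)[of r s] primeideal_subringD(6)[OF A P, of r s] by blast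
  moreover have "r \<otimes> s \<otimes> x \<in> A" if "x \<in> insert y S" for x
  proof (cases "x = y")
    case True
    have "r \<otimes> s \<otimes> y = s \<otimes> (r \<otimes> y)" using c r by (simp add: m_ac)
    then show ?thesis using True AE(6)[of s "r \<otimes> y"] s r by simp
  next
    case False
    have "x \<in> carrier R"
      using that insert.prems localization_iff[OF A P] by blast
    then have "r \<otimes> s \<otimes> x = r \<otimes> (s \<otimes> x)" using c by (simp add: m_assoc)
    then show ?thesis using False that AE(6)[of r "s \<otimes> x"] s r by simp
  qed
  ultimately show ?case by blast
qed

lemma zariski_open_neighbourhood:
  assumes U: "openin (zariski_topology R) U" and V: "V \<in> U"
  obtains S where "finite S" "S \<subseteq> V" "\<And>W. W \<in> Zar R \<Longrightarrow> S \<subseteq> W \<Longrightarrow> W \<in> U"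
proof -
  obtain \<B> where B: "\<B> \<subseteq> zariski_basis R" "\<Union>\<B> = U"
    using U unfolding openin_zariski_topology union_of_def by auto
  then obtain T where T: "T \<in> \<B>" "V \<in> T" using V by blast
  then have "T \<in> zariski_basis R" using B(1) by blast
  then obtain S where "finite S" "T = {V \<in> Zar R. S \<subseteq> V}"
    unfolding zariski_basis_def by blast
  then show ?thesis using that[of S] T B by blast
qed

text \<open>The elements \<open>s\<close> for which finitely many sets of the cover contain all localizations at
  maximal ideals without \<open>s\<close> form an ideal. A common denominator of the finitely many elements
  that define a basic neighbourhood of \<open>A\<^sub>M\<close> shows that this ideal is not contained in \<open>M\<close>, so it
  contains 1.\<close>

lemma compactin_max_localizations:
  assumes A: "subring A R" and Z: "max_localizations R A \<subseteq> Zar R"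
  shows "compactin (zariski_topology R) (max_localizations R A)"
  unfolding compactin_def topspace_zariski_topology
proof (intro conjI Z allI impI)
  fix \<U> assume "(\<forall>U\<in>\<U>. openin (zariski_topology R) U) \<and> max_localizations R A \<subseteq> \<Union>\<U>"
  then have op: "\<And>U. U \<in> \<U> \<Longrightarrow> openin (zariski_topology R) U"
    and cov: "max_localizations R A \<subseteq> \<Union>\<U>" by blast+
  note AE = subringE[OF A]
  have P: "primeideal M (R\<lparr>carrier := A\<rparr>)" if "maximalideal M (R\<lparr>carrier := A\<rparr>)" for M
    by (rule maximal_imp_primeideal_subring[OF A that])
  define covers where "covers s \<F> \<longleftrightarrow> finite \<F> \<and> \<F> \<subseteq> \<U> \<and>
    (\<forall>M. maximalideal M (R\<lparr>carrier := A\<rparr>) \<and> s \<notin> M \<longrightarrow> localization_in R A M \<in> \<Union>\<F>)"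
    for s \<F>
  define I where "I = {s \<in> A. \<exists>\<F>. covers s \<F>}"
  have IA: "ideal I (R\<lparr>carrier := A\<rparr>)"
    unfolding ideal_subring_iff[OF A]
  proof (intro conjI ballI)
    show "I \<subseteq> A" by (auto simp: I_def)
    have "covers \<zero> {}"
      using primeideal_subringD(2)[OF A P] by (auto simp: covers_def)
    then show "\<zero> \<in> I" using AE(2) by (auto simp: I_def)
    fix s assume s: "s \<in> I"
    then obtain \<F> where sA: "s \<in> A" and F: "covers s \<F>" by (auto simp: I_def)
    show "s \<oplus> r \<in> I" if r: "r \<in> I" for r
    proof -
      obtain \<G> where rA: "r \<in> A" and G: "covers r \<G>" using r by (auto simp: I_def)
      have "s \<notin> M \<or> r \<notin> M" if "maximalideal M (R\<lparr>carrier := A\<rparr>)" "s \<oplus> r \<notin> M" for M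
        using primeideal_subringD(4)[OF A P[OF that(1)]] that(2) by blast
      then have "covers (s \<oplus> r) (\<F> \<union> \<G>)"
        using F G unfolding covers_def by (simp, blast)
      then show ?thesis using AE(7)[OF sA rA] by (auto simp: I_def)
    qed
    show "a \<otimes> s \<in> I" if a: "a \<in> A" for a
    proof -
      have "s \<notin> M" if "maximalideal M (R\<lparr>carrier := A\<rparr>)" "a \<otimes> s \<notin> M" for M
        using primeideal_subringD(5)[OF A P[OF that(1)] a] that(2) by blast
      then have "covers (a \<otimes> s) \<F>" using F unfolding covers_def by blast
      then show ?thesis using AE(6)[OF a sA] by (auto simp: I_def)
    qed
  qed
  have "\<one> \<in> I"
  proof (rule ccontr)
    assume "\<one> \<notin> I"
    then obtain M where M: "maximalideal M (R\<lparr>carrier := A\<rparr>)" "I \<subseteq> M"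
      by (rule subring_max_ideal_above[OF A IA])
    have "localization_in R A M \<in> max_localizations R A"
      using M(1) by (auto simp: max_localizations_def Max_ideals_def)
    then obtain U where U: "U \<in> \<U>" "localization_in R A M \<in> U" using cov by blast
    obtain S where S: "finite S" "S \<subseteq> localization_in R A M"
      "\<And>W. W \<in> Zar R \<Longrightarrow> S \<subseteq> W \<Longrightarrow> W \<in> U"
      by (rule zariski_open_neighbourhood[OF op[OF U(1)] U(2)]) blast
    obtain s where s: "s \<in> A - M" "\<And>x. x \<in> S \<Longrightarrow> s \<otimes> x \<in> A"
      using localization_common_denominator[OF A P[OF M(1)] S(1,2)] by blast
    have Sc: "S \<subseteq> carrier R" using S(2) localization_iff[OF A P[OF M(1)]] by blast
    have "localization_in R A N \<in> U" if N: "maximalideal N (R\<lparr>carrier := A\<rparr>)" "s \<notin> N" for N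
    proof (rule S(3))
      show "localization_in R A N \<in> Zar R"
        using Z N(1) by (auto simp: max_localizations_def Max_ideals_def)
      show "S \<subseteq> localization_in R A N"
        using s Sc N(2) localization_iff[OF A P[OF N(1)]] by blast
    qed
    then have "covers s {U}" using U(1) by (auto simp: covers_def)
    then have "s \<in> I" using s(1) by (auto simp: I_def)
    then show False using M(2) s(1) by blast
  qed
  then obtain \<F> where "covers \<one> \<F>" by (auto simp: I_def)
  then have "finite \<F> \<and> \<F> \<subseteq> \<U> \<and> max_localizations R A \<subseteq> \<Union>\<F>"
    using primeideal_subringD(3)[OF A P]
    unfolding covers_def max_localizations_def Max_ideals_def by blast
  then show "\<exists>\<F>. finite \<F> \<and> \<F> \<subseteq> \<U> \<and> max_localizations R A \<subseteq> \<Union>\<F>" by blast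
qed

lemma pruefer_max_ideals_nonempty:
  assumes A: "A \<in> one_dim_pruefer_domains R"
  shows "Max_ideals (R\<lparr>carrier := A\<rparr>) \<noteq> {}"
proof -
  note sub = one_dim_pruefer_domainsD(1)[OF A]
  note P = primeideal_zero_subring[OF sub]
  obtain M where "maximalideal M (R\<lparr>carrier := A\<rparr>)"
    by (rule subring_max_ideal_above[OF sub primeideal.axioms(1)[OF P]]) simp
  then show ?thesis by (auto simp: Max_ideals_def)
qed

lemma max_localizations_in_qc_rank_one_sets:
  assumes A: "A \<in> one_dim_pruefer_domains R"
  shows "max_localizations R A \<in> qc_rank_one_sets R"
proof -
  note AD = one_dim_pruefer_domainsD[OF A]
  note P = maximal_imp_primeideal_subring[OF AD(1)]
  have r1: "max_localizations R A \<subseteq> rank_one_valuation_rings R"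
    using pruefer_localization_rank_one[OF A] by (auto simp: max_localizations_def Max_ideals_def)
  then have Z: "max_localizations R A \<subseteq> Zar R" by (auto simp: rank_one_valuation_rings_def)
  obtain j where j: "j \<noteq> \<zero>" "\<And>M. maximalideal M (R\<lparr>carrier := A\<rparr>) \<Longrightarrow> j \<in> M"
    by (rule pruefer_jacobson_element[OF A]) blast
  have "j \<in> val_max_ideal R (localization_in R A M)" if "maximalideal M (R\<lparr>carrier := A\<rparr>)" for M
    using localization_max_ideal_contract[OF AD(1) P[OF that] pruefer_localization_Zar[OF A that]]
      j(2)[OF that] by blast
  then have "j \<in> val_max_Inter R (max_localizations R A)"
    by (auto simp: val_max_Inter_def max_localizations_def Max_ideals_def)
  then have "val_max_Inter R (max_localizations R A) \<noteq> {\<zero>}" using j(1) by blast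
  then show ?thesis
    using r1 compactin_max_localizations[OF AD(1) Z] pruefer_max_ideals_nonempty[OF A]
    by (simp add: qc_rank_one_sets_def max_localizations_def)
qed

end


section \<open>The correspondence\<close>

theorem mainTheorem2:
  fixes F :: "('a, 'b) ring_scheme"
  assumes "field F"
  shows "bij_betw val_Inter (qc_rank_one_sets F) (one_dim_pruefer_domains F) \<and>
         bij_betw (max_localizations F) (one_dim_pruefer_domains F) (qc_rank_one_sets F) \<and>
         (\<forall>X \<in> qc_rank_one_sets F. max_localizations F (val_Inter X) = X) \<and>
         (\<forall>A \<in> one_dim_pruefer_domains F. val_Inter (max_localizations F A) = A)"
proof -
  interpret field F by (rule assms)
  have into: "val_Inter ` qc_rank_one_sets F \<subseteq> one_dim_pruefer_domains F"
    using val_Inter_in_one_dim_pruefer_domains by blast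
  have onto: "max_localizations F ` one_dim_pruefer_domains F \<subseteq> qc_rank_one_sets F"
    using max_localizations_in_qc_rank_one_sets by blast
  have X: "\<forall>X \<in> qc_rank_one_sets F. max_localizations F (val_Inter X) = X"
    using max_localizations_val_Inter by blast
  have A: "\<forall>A \<in> one_dim_pruefer_domains F. val_Inter (max_localizations F A) = A"
    using Inter_max_localizations one_dim_pruefer_domainsD(1) pruefer_max_ideals_nonempty by blast
  show ?thesis
    using bij_betw_byWitness[OF X A into onto] bij_betw_byWitness[OF A X onto into] X A by blast
qed

end
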